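(* Let $k$ be a field of characteristic zero and let $A'=R/I'$ be any standard graded artinian $k$-algebra of codimension $3$ ($R=k[x_1,x_2,x_3]$) whose $h$-vector is equal to the $h$-vector of some compressed algebra. Let $e$ be the multiplicity of $A'$ and, for $i=1,2,3$, let $m_i$ and $M_i$ be respectively the smallest and the largest shift appearing in the $i$-th module $F_i$ of the minimal free resolution of $A'$. Then $$\frac{m_1 m_2 m_3}{6}\le e\le \frac{M_1 M_2 M_3}{6}.$$
   Context: Conventions. $k$ is a field of characteristic zero and $R=k[x_1,\dots,x_r]$ with all $x_i$ of degree $1$. An algebra is a quotient $A=R/I$ with $I$ a homogeneous ideal containing no nonzero form of degree $1$, and $A$ artinian. Its $h$-vector is $h(A)=(h_0,h_1,\dots,h_c)$, $h_i=\dim_k A_i$, where $c$ (the socle degree) is the last index with $A_c\ne 0$. The codimension of $A$ is $h_1=r$ and its multiplicity is $e=h_0+\dots+h_c=\dim_k A$. Socle-vector. The socle of $A$ is $\mathrm{soc}(A)=\{a\in A : a\overline{m}=0\}$, $\overline m$ being the maximal homogeneous ideal of $A$; the socle-vector is $s(A)=(s_0=0,s_1,\dots,s_c)$, $s_i=\dim_k \mathrm{soc}(A)_i$. Minimal free resolution. The graded minimal free resolution of $A$ over $R$ is $0\to F_r\to\dots\to F_1\to R\to R/I\to 0$ with $F_i=\bigoplus_j R^{\beta_{i,j}}(-j)$; the shifts appearing in $F_i$ are the integers $j$ with $\beta_{i,j}>0$. Compressed algebras. Put $N(r,d)=\dim_k R_d=\binom{r-1+d}{d}$. Given a codimension $r$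 and a socle-vector $s=(0,s_1,\dots,s_c)$, for $d=0,1,\dots,c$ let $$r_d=N(r,d)-N(r,0)s_d-N(r,1)s_{d+1}-\dots-N(r,c-d)s_c .$$ One has $r_0<0$, $r_c\ge 0$ and $r_{d+1}>r_d$ for every $d$; let $b$ be the unique index with $1\le b\le c$, $r_b\ge 0$ and $r_{b-1}<0$. Suppose $s_1=\dots=s_{b-1}=0$. An algebra of codimension $r$ and socle-vector $s$ is called compressed (with respect to $(r,s)$) if its $h$-vector is $(h_0,\dots,h_c)$ with $h_i=\min\{N(r,i)-r_i,\;N(r,i)\}$ for $i=0,\dots,c$. The phrase "a compressed algebra" always means compressed with respect to some pair $(r,s)$ satisfying $s_1=\dots=s_{b-1}=0$. *)

theory Defs
  imports "HOL-Library.Poly_Mapping" "HOL-Algebra.QuotRing" "HOL-Algebra.Embedded_Algebras"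
begin

section \<open>The polynomial ring and graded quotients\<close>

text \<open>Monomials are exponent vectors; the variable with index \<open>i\<close> is the
  monomial \<open>Poly_Mapping.single i 1\<close>. The ring \<open>k[x\<^sub>1, \<dots>, x\<^sub>r]\<close> consists of the
  polynomials in the variables with index \<open>< r\<close>.\<close>

type_synonym 'k mpoly = "(nat \<Rightarrow>\<^sub>0 nat) \<Rightarrow>\<^sub>0 'k"

definition mpoly_ring :: "nat \<Rightarrow> 'k::field mpoly ring" where
  "mpoly_ring r =
     \<lparr>carrier = {p. \<forall>m\<in>Poly_Mapping.keys p. Poly_Mapping.keys m \<subseteq> {..<r}},
      mult = (*), one = 1, zero = 0, add = (+)\<rparr>"

definition mono_degree :: "(nat \<Rightarrow>\<^sub>0 nat) \<Rightarrow> nat" where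
  "mono_degree m = (\<Sum>x\<in>Poly_Mapping.keys m. Poly_Mapping.lookup m x)"

text \<open>The graded piece \<open>R\<^sub>d\<close> (zero for negative \<open>d\<close>; integer degrees are needed for the
  shifted modules \<open>R(-j)\<close> below).\<close>

definition forms :: "nat \<Rightarrow> int \<Rightarrow> 'k::field mpoly set" where
  "forms r d = {p \<in> carrier (mpoly_ring r).
     \<forall>m\<in>Poly_Mapping.keys p. int (mono_degree m) = d}"

definition hom_component :: "nat \<Rightarrow> 'k::field mpoly \<Rightarrow> 'k mpoly" where
  "hom_component d p = Poly_Mapping.mapp (\<lambda>m c. if mono_degree m = d then c else 0) p"

definition irrelevant_ideal :: "nat \<Rightarrow> 'k::field mpoly set" where
  "irrelevant_ideal r = {p \<in> carrier (mpoly_ring r). Poly_Mapping.lookup p 0 = 0}"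

definition homogeneous_ideal :: "nat \<Rightarrow> 'k::field mpoly set \<Rightarrow> bool" where
  "homogeneous_ideal r I \<longleftrightarrow>
     ideal I (mpoly_ring r) \<and> (\<forall>p\<in>I. \<forall>d. hom_component d p \<in> I)"

definition artinian_ring :: "('a, 'b) ring_scheme \<Rightarrow> bool" where
  "artinian_ring A \<longleftrightarrow>
     (\<forall>J :: nat \<Rightarrow> 'a set. (\<forall>n. ideal (J n) A) \<and> (\<forall>n. J (Suc n) \<subseteq> J n) \<longrightarrow>
        (\<exists>n. \<forall>m\<ge>n. J m = J n))"

definition quot_alg :: "nat \<Rightarrow> 'k::field mpoly set \<Rightarrow> 'k mpoly set ring" where
  "quot_alg r I = mpoly_ring r Quot I"

definition residue_class :: "nat \<Rightarrow> 'k::field mpoly set \<Rightarrow> 'k mpoly \<Rightarrow> 'k mpoly set" where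
  "residue_class r I p = I +>\<^bsub>mpoly_ring r\<^esub> p"

text \<open>Being nonzero is implied by the absence of linear forms in \<open>I\<close> only if \<open>r > 0\<close>.\<close>

definition std_artinian_algebra :: "nat \<Rightarrow> 'k::field mpoly set \<Rightarrow> bool" where
  "std_artinian_algebra r I \<longleftrightarrow>
     homogeneous_ideal r I \<and> I \<noteq> carrier (mpoly_ring r) \<and>
     I \<inter> forms r 1 = {0} \<and> artinian_ring (quot_alg r I)"

section \<open>h-vector and socle-vector\<close>

text \<open>The copy of the ground field \<open>k\<close> inside \<open>A = R/I\<close>, and dimension over it.\<close>

definition base_field :: "nat \<Rightarrow> 'k::field mpoly set \<Rightarrow> 'k mpoly set set" where
  "base_field r I = (\<lambda>c. residue_class r I (Poly_Mapping.single 0 c)) ` UNIV"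

definition kdim :: "nat \<Rightarrow> 'k::field mpoly set \<Rightarrow> 'k mpoly set set \<Rightarrow> nat" where
  "kdim r I V = (THE n. ring.dimension (quot_alg r I) n (base_field r I) V)"

definition graded_piece :: "nat \<Rightarrow> 'k::field mpoly set \<Rightarrow> nat \<Rightarrow> 'k mpoly set set" where
  "graded_piece r I i = residue_class r I ` forms r (int i)"

definition hilb :: "nat \<Rightarrow> 'k::field mpoly set \<Rightarrow> nat \<Rightarrow> nat" where
  "hilb r I i = kdim r I (graded_piece r I i)"

definition codimension :: "nat \<Rightarrow> 'k::field mpoly set \<Rightarrow> nat" where
  "codimension r I = hilb r I 1"

definition socle_degree :: "nat \<Rightarrow> 'k::field mpoly set \<Rightarrow> nat" where
  "socle_degree r I = (GREATEST i. graded_piece r I i \<noteq> {\<zero>\<^bsub>quot_alg r I\<^esub>})"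

definition h_vector :: "nat \<Rightarrow> 'k::field mpoly set \<Rightarrow> nat list" where
  "h_vector r I = map (hilb r I) [0..<Suc (socle_degree r I)]"

definition alg_multiplicity :: "nat \<Rightarrow> 'k::field mpoly set \<Rightarrow> nat" where
  "alg_multiplicity r I = sum_list (h_vector r I)"

definition socle :: "nat \<Rightarrow> 'k::field mpoly set \<Rightarrow> 'k mpoly set set" where
  "socle r I = {a \<in> carrier (quot_alg r I).
     \<forall>x \<in> residue_class r I ` irrelevant_ideal r. a \<otimes>\<^bsub>quot_alg r I\<^esub> x = \<zero>\<^bsub>quot_alg r I\<^esub>}"

definition socle_vector :: "nat \<Rightarrow> 'k::field mpoly set \<Rightarrow> nat list" where
  "socle_vector r I =
     map (\<lambda>i. kdim r I (socle r I \<inter> graded_piece r I i)) [0..<Suc (socle_degree r I)]"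

section \<open>Compressed algebras\<close>

definition num_monos :: "nat \<Rightarrow> nat \<Rightarrow> nat" where
  "num_monos r d = (r + d - 1) choose d"

text \<open>The integer \<open>r\<^sub>d\<close> attached to \<open>r\<close> and \<open>s = (s\<^sub>0, \<dots>, s\<^sub>c)\<close>, where \<open>c = length s - 1\<close>.\<close>

definition compr_r :: "nat \<Rightarrow> nat list \<Rightarrow> nat \<Rightarrow> int" where
  "compr_r r s d = int (num_monos r d) -
     (\<Sum>i = d..length s - 1. int (num_monos r (i - d)) * int (s ! i))"

text \<open>The index \<open>b\<close> below is unique, since \<open>r\<^sub>d\<close> is increasing in \<open>d\<close>.\<close>

definition compressed_algebra :: "nat \<Rightarrow> nat list \<Rightarrow> 'k::field mpoly set \<Rightarrow> bool" where
  "compressed_algebra r s I \<longleftrightarrow>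
     std_artinian_algebra r I \<and> codimension r I = r \<and> socle_vector r I = s \<and>
     (\<exists>b. 1 \<le> b \<and> b \<le> length s - 1 \<and> compr_r r s b \<ge> 0 \<and> compr_r r s (b - 1) < 0 \<and>
        (\<forall>i. 1 \<le> i \<and> i < b \<longrightarrow> s ! i = 0)) \<and>
     (\<forall>i \<le> length s - 1. int (hilb r I i) =
        min (int (num_monos r i) - compr_r r s i) (int (num_monos r i)))"

section \<open>Graded minimal free resolutions\<close>

text \<open>A list \<open>D = [j\<^sub>0, \<dots>, j\<^sub>n\<^sub>-\<^sub>1]\<close> of shifts represents the graded free module
  \<open>R(-j\<^sub>0) \<oplus> \<dots> \<oplus> R(-j\<^sub>n\<^sub>-\<^sub>1)\<close>; so the shifts appearing in it are the elements of \<open>set D\<close>,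
  each with \<open>\<beta>\<close> equal to its number of occurrences. Module elements are functions that
  vanish outside \<open>{..<n}\<close>.\<close>

definition free_mod :: "nat \<Rightarrow> int list \<Rightarrow> (nat \<Rightarrow> 'k::field mpoly) set" where
  "free_mod r D = {v. (\<forall>a<length D. v a \<in> carrier (mpoly_ring r)) \<and> (\<forall>a\<ge>length D. v a = 0)}"

definition free_mod_piece :: "nat \<Rightarrow> int list \<Rightarrow> int \<Rightarrow> (nat \<Rightarrow> 'k::field mpoly) set" where
  "free_mod_piece r D d = {v \<in> free_mod r D. \<forall>a<length D. v a \<in> forms r (d - D ! a)}"

definition graded_hom ::
    "nat \<Rightarrow> int list \<Rightarrow> int list \<Rightarrow> ((nat \<Rightarrow> 'k::field mpoly) \<Rightarrow> (nat \<Rightarrow> 'k mpoly)) \<Rightarrow> bool" where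
  "graded_hom r D E f \<longleftrightarrow>
     f ` free_mod r D \<subseteq> free_mod r E \<and>
     (\<forall>v\<in>free_mod r D. \<forall>w\<in>free_mod r D. f (\<lambda>a. v a + w a) = (\<lambda>a. f v a + f w a)) \<and>
     (\<forall>p\<in>carrier (mpoly_ring r). \<forall>v\<in>free_mod r D. f (\<lambda>a. p * v a) = (\<lambda>a. p * f v a)) \<and>
     (\<forall>d. f ` free_mod_piece r D d \<subseteq> free_mod_piece r E d)"

text \<open>\<open>0 \<rightarrow> F\<^sub>r \<rightarrow> \<dots> \<rightarrow> F\<^sub>1 \<rightarrow> F\<^sub>0 = R \<rightarrow> R/I \<rightarrow> 0\<close> with \<open>F\<^sub>i\<close> given by the shifts \<open>D i\<close>
  and \<open>\<phi> i : F\<^sub>i \<rightarrow> F\<^sub>i\<^sub>-\<^sub>1\<close>. Exactness at \<open>F\<^sub>0\<close> says that the image of \<open>\<phi> 1\<close> is \<open>I\<close>. The complex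
  is continued by \<open>F\<^sub>i = 0\<close> for \<open>i > r\<close>, so that exactness at \<open>F\<^sub>r\<close> is injectivity of \<open>\<phi> r\<close>.
  The last conjunct is minimality: \<open>\<phi>\<^sub>i(F\<^sub>i) \<subseteq> \<mm> F\<^sub>i\<^sub>-\<^sub>1\<close>.\<close>

definition minimal_graded_free_resolution ::
    "nat \<Rightarrow> 'k::field mpoly set \<Rightarrow> (nat \<Rightarrow> int list) \<Rightarrow>
      (nat \<Rightarrow> (nat \<Rightarrow> 'k mpoly) \<Rightarrow> (nat \<Rightarrow> 'k mpoly)) \<Rightarrow> bool" where
  "minimal_graded_free_resolution r I D \<phi> \<longleftrightarrow>
     D 0 = [0] \<and> (\<forall>i>r. D i = []) \<and>
     (\<forall>i\<ge>1. graded_hom r (D i) (D (i - 1)) (\<phi> i)) \<and>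
     (\<lambda>v. v 0) ` \<phi> 1 ` free_mod r (D 1) = I \<and>
     (\<forall>i\<ge>1. \<phi> (Suc i) ` free_mod r (D (Suc i)) = {v \<in> free_mod r (D i). \<phi> i v = (\<lambda>_. 0)}) \<and>
     (\<forall>i\<ge>1. \<forall>v\<in>free_mod r (D i). \<forall>a. \<phi> i v a \<in> irrelevant_ideal r)"

end

(* Let h be the Hilbert function of A', N(d) = dim R_d, and let b, s, c belong to the compressed algebra: h(i) = N(i) for
   i < b and h(i) = sum over j of s_j N(j - i) for b <= i <= c. The third difference of h at d is the
   alternating count of the shifts equal to d. Hence b + 2 is a shift of F_2; comparing the
   Koszul complex with the resolution, a nonzero socle element in degree i makes i + 3 a shift of
   F_3, so c + 3 is one.

   Upper bound: M_2 >= b + 2 and M_3 >= c + 3. Estimating the sum of the h(i), i >= b, for each s_j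
   separately gives the bound if M_1 > b. If M_1 = b, the third difference of h at b + 1 is
   nonnegative, and this sharpens the estimate.

   Lower bound: put p = m_3 - 3. There is no socle in degrees below p, so multiplication by the three
   variables has no common kernel there, which forces (p - i) h(i) <= (p - i + 2) h(i + 1). These
   inequalities bound the sum of the h(i), i <= p, from below, with a case distinction on m_1 and m_2
   that uses again the third differences at b and b + 1. *)

theory Submission
  imports Defs "HOL-Library.Function_Algebras"
begin

text \<open>The shifts of \<open>A'\<close> are not determined by \<open>h\<close>: equal shifts in
  neighbouring modules cancel in the third difference, and \<open>A'\<close> need not be compressed.
  So the proof works with signs only. Continue the sum formula for \<open>h\<close> from
  \<open>i >= b\<close> down to \<open>b - 1\<close>. Its third difference at \<open>b + 2\<close>
  is 0, so the true one is the excess of the continued value over \<open>N(b - 1)\<close>. This is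
  positive, since \<open>r_(b-1) < 0\<close> when \<open>b > 1\<close> and since
  \<open>h(1) = 3\<close> when \<open>b = 1\<close>; and in positive degrees only \<open>F_2\<close>
  counts with a positive sign. At \<open>b + 1\<close> the third difference is
  \<open>h(b + 1) - 3 h(b) + b (b + 2)\<close>, because
  \<open>3 N(b - 1) - N(b - 2) = b (b + 2)\<close>; this is where the products
  \<open>b (b + 2) (c + 3)\<close> and \<open>b (b + 2) (p + 3)\<close> come from. The growth
  inequality is an equality for \<open>h(p - k) = N(k)\<close>, as
  \<open>N(k + 1) / N(k) = (k + 3) / (k + 1)\<close>. It is a statement about commuting operators
  without common kernel, applied to the graded pieces of \<open>A'\<close> read downwards from
  degree \<open>p\<close>. All dimensions are taken of subspaces of polynomials: a linear projection
  with kernel \<open>I\<close> models the quotient inside the polynomial ring.\<close>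

section \<open>Linear algebra\<close>

text \<open>The ambient spaces are infinite-dimensional and \<open>dim\<close> is 0 on a space
  without a finite basis, so finiteness is a property of subsets. The span is a parameter because
  statements about a pair of vector spaces need it for both.\<close>

definition finspan :: "('b set \<Rightarrow> 'b set) \<Rightarrow> 'b set \<Rightarrow> bool" where
  "finspan sp V \<longleftrightarrow> (\<exists>W. finite W \<and> V \<subseteq> sp W)"

context vector_space
begin

lemma fin_dim_subset: "finspan span V \<Longrightarrow> U \<subseteq> V \<Longrightarrow> finspan span U"
  unfolding finspan_def by blast

lemma fin_dim_independent_finite: "finspan span V \<Longrightarrow> B \<subseteq> V \<Longrightarrow> independent B \<Longrightarrow> finite B"
  unfolding finspan_def using independent_span_bound by (meson subset_trans)

lemma fin_dim_basis:
  assumes "finspan span V" "subspace V"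
  obtains B where "finite B" "independent B" "B \<subseteq> V" "span B = V" "card B = dim V"
proof -
  obtain B where B: "B \<subseteq> V" "independent B" "V \<subseteq> span B" "card B = dim V"
    using basis_exists by blast
  moreover have "finite B" using B assms(1) fin_dim_independent_finite by blast
  moreover have "span B = V" using B assms(2) span_minimal by blast
  ultimately show ?thesis using that by blast
qed

lemma dim_mono_fin:
  assumes "finspan span V" "U \<subseteq> V"
  shows "dim U \<le> dim V"
proof -
  obtain B where B: "B \<subseteq> V" "independent B" "V \<subseteq> span B" "card B = dim V"
    using basis_exists by blast
  moreover have "finite B"
    using B assms(1) fin_dim_independent_finite by blast
  ultimately show ?thesis
    using assms(2) dim_le_card[of U B] by auto
qed

lemma dim_zero_space [simp]: "dim {0} = 0"
  by (rule dim_unique[of "{}"]) (auto simp: independent_empty)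

lemma fin_dim_zero [simp]: "finspan span {0}"
  unfolding finspan_def by (intro exI[of _ "{}"]) auto

lemma fin_dim_dim_eq_0:
  assumes "finspan span V" "dim V = 0"
  shows "V \<subseteq> {0}"
proof -
  obtain B where B: "B \<subseteq> V" "independent B" "V \<subseteq> span B" "card B = dim V"
    using basis_exists by blast
  moreover have "finite B"
    using B assms(1) fin_dim_independent_finite by blast
  ultimately show ?thesis using assms(2) by auto
qed

end

context vector_space_pair
begin

text \<open>Linearity is required on \<open>V\<close> only, since the maps of a resolution are
  specified only on the free modules. A basis of the kernel is extended to one of \<open>V\<close>;
  the added vectors are mapped injectively onto a basis of the image.\<close>

lemma rank_nullity:
  assumes V: "vs1.subspace V" "finspan vs1.span V"
    and add: "\<And>x y. x \<in> V \<Longrightarrow> y \<in> V \<Longrightarrow> f (x + y) = f x + f y"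
    and scl: "\<And>c x. x \<in> V \<Longrightarrow> f (s1 c x) = s2 c (f x)"
  shows "vs1.dim V = vs1.dim {v\<in>V. f v = 0} + vs2.dim (f ` V)"
    and "vs2.subspace (f ` V)" and "finspan vs2.span (f ` V)" and "vs1.subspace {v\<in>V. f v = 0}"
proof -
  let ?K = "{v\<in>V. f v = 0}"
  have f0: "f 0 = 0"
    using scl[OF vs1.subspace_0[OF V(1)], of 0] by simp
  show K: "vs1.subspace ?K"
    using V(1) add scl f0 by (intro vs1.subspaceI) (auto simp: vs1.subspace_def)
  obtain B where B: "finite B" "vs1.independent B" "B \<subseteq> ?K" "vs1.span B = ?K" "card B = vs1.dim ?K"
    by (rule vs1.fin_dim_basis[OF vs1.fin_dim_subset[OF V(2)] K]) auto
  obtain C where C: "B \<subseteq> C" "C \<subseteq> V" "vs1.independent C" "V \<subseteq> vs1.span C"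
    using vs1.maximal_independent_subset_extend[of B V] B by blast
  have finC: "finite C"
    using vs1.fin_dim_independent_finite V C by blast
  have spanC: "vs1.span C = V"
    using C V vs1.span_minimal by blast
  \<comment> \<open>\<open>f\<close> may be arbitrary outside \<open>V\<close>; \<open>g\<close> is
    linear on the whole space and agrees with \<open>f\<close> on \<open>V\<close>.\<close>
  define g where "g = construct C f"
  have lg: "Vector_Spaces.linear s1 s2 g"
    unfolding g_def by (rule linear_construct[OF C(3)])
  have gf: "g v = f v" if "v \<in> V" for v
  proof -
    have "v \<in> vs1.span C" using that C by auto
    then have "v \<in> V \<and> g v = f v"
    proof (induction rule: vs1.span_induct_alt)
      case base
      then show ?case using f0 linear_0[OF lg] vs1.subspace_0[OF V(1)] by simp
    next
      case (step c x y)
      have xy: "x \<in> V" "y \<in> V" using step C(2) by auto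
      have gx: "g x = f x"
        unfolding g_def by (rule construct_basis[OF C(3) step(1)])
      have "g (s1 c x + y) = s2 c (f x) + f y"
        using linear_add[OF lg] linear_scale[OF lg] gx step by simp
      also have "\<dots> = f (s1 c x + y)"
        using add[OF vs1.subspace_scale[OF V(1) xy(1)] xy(2)] scl[OF xy(1)] by simp
      finally show ?case
        using V(1) xy vs1.subspace_add vs1.subspace_scale by simp
    qed
    then show ?thesis by simp
  qed
  let ?D = "C - B"
  \<comment> \<open>Such a vector lies in the kernel, hence also in the span of \<open>B\<close>;
    its coordinates with respect to \<open>C\<close> then vanish both on \<open>B\<close> and on
    \<open>C - B\<close>.\<close>
  have inter: "v = 0" if "v \<in> vs1.span ?D" "g v = 0" for v
  proof -
    have vV: "v \<in> V" using that(1) spanC vs1.span_mono[of ?D C] by auto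
    then have vB: "v \<in> vs1.span B" using that(2) gf B(4) by auto
    show "v = 0"
    proof -
      have rD: "vs1.representation C v = vs1.representation ?D v"
        using vs1.representation_extend[OF C(3) that(1)] by auto
      have rB: "vs1.representation C v = vs1.representation B v"
        using vs1.representation_extend[OF C(3) vB] C(1) by auto
      have "vs1.representation C v b = 0" for b
        using vs1.representation_ne_zero[of ?D v b] vs1.representation_ne_zero[of B v b]
        unfolding rD rB[symmetric] by (cases "b \<in> B") (auto simp flip: rD simp: rB)
      then show ?thesis
        using vs1.sum_nonzero_representation_eq[OF C(3), of v] vV spanC by simp
    qed
  qed
  have injD: "inj_on g (vs1.span ?D)"
    using linear_inj_on_iff_eq_0[OF lg, of "vs1.span ?D"] inter by (simp add: vs1.subspace_span)
  have indD: "vs1.independent ?D"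
    using C(3) vs1.dependent_mono by blast
  have gD: "vs2.independent (g ` ?D)"
    by (rule linear_independent_injective_image[OF lg indD injD])
  have img: "g ` V = vs2.span (g ` ?D)"
  proof -
    have "g ` V = vs2.span (g ` C)"
      using linear_span_image[OF lg, of C] spanC by simp
    also have "\<dots> = vs2.span (g ` ?D)"
    proof -
      have "g b = 0" if "b \<in> B" for b using that B(3) gf by auto
      then have "g ` C \<subseteq> insert 0 (g ` ?D)" by blast
      then have "vs2.span (g ` C) \<subseteq> vs2.span (g ` ?D)"
        using vs2.span_mono[of "g ` C" "insert 0 (g ` ?D)"] by simp
      moreover have "vs2.span (g ` ?D) \<subseteq> vs2.span (g ` C)"
        by (intro vs2.span_mono) auto
      ultimately show ?thesis by blast
    qed
    finally show ?thesis .
  qed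
  have fg: "f ` V = g ` V" using gf by auto
  show "vs2.subspace (f ` V)" unfolding fg img by (rule vs2.subspace_span)
  show "finspan vs2.span (f ` V)"
    unfolding fg img finspan_def using finC by (intro exI[of _ "g ` ?D"]) auto
  have "inj_on g ?D" using injD by (rule inj_on_subset) (rule vs1.span_superset)
  then have "vs2.dim (f ` V) = card ?D"
    unfolding fg img using vs2.dim_span_eq_card_independent[OF gD] by (simp add: card_image)
  moreover have "vs1.dim V = card C"
    using vs1.dim_span_eq_card_independent[OF C(3)] spanC by simp
  moreover have "card C = card B + card ?D"
    using finC C(1) B(1) by (metis card_Diff_subset card_mono le_add_diff_inverse)
  ultimately show "vs1.dim V = vs1.dim ?K + vs2.dim (f ` V)"
    using B(5) by simp
qed

end

context vector_space
begin

lemma rank_nullity_linear: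
  assumes "subspace V" "finspan span V" "Vector_Spaces.linear scale scale f"
  shows "dim V = dim {v\<in>V. f v = 0} + dim (f ` V)"
    and "subspace (f ` V)" and "finspan span (f ` V)" and "subspace {v\<in>V. f v = 0}"
proof -
  interpret P: vector_space_pair scale scale by unfold_locales
  note r = P.rank_nullity[OF assms(1,2), of f, OF P.linear_add[OF assms(3)] P.linear_scale[OF assms(3)]]
  show "dim V = dim {v\<in>V. f v = 0} + dim (f ` V)"
    and "subspace (f ` V)" and "finspan span (f ` V)" and "subspace {v\<in>V. f v = 0}"
    by (fact r)+
qed

text \<open>Split \<open>U\<^sub>k\<close> into the kernel and the image of the last operator: on the kernels one operator
  fewer is needed, and the images form a family of the same kind shifted by one.\<close>

lemma commuting_family_growth:
  assumes "\<And>i. Vector_Spaces.linear scale scale (X i)"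
    and "\<And>k. subspace (U k)" "\<And>k. finspan span (U k)"
    and "\<And>i k. i < r \<Longrightarrow> X i ` U (Suc k) \<subseteq> U k"
    and "\<And>i j k v. v \<in> U k \<Longrightarrow> X i (X j v) = X j (X i v)"
    and "\<And>k v. v \<in> U (Suc k) \<Longrightarrow> (\<And>i. i < r \<Longrightarrow> X i v = 0) \<Longrightarrow> v = 0"
  shows "Suc k * dim (U (Suc k)) \<le> (k + r) * dim (U k)"
  using assms
proof (induction r arbitrary: k U)
  case 0
  then have "U (Suc k) \<subseteq> {0}" by blast
  then have "dim (U (Suc k)) = 0"
    using dim_mono_fin[OF fin_dim_zero] by fastforce
  then show ?case by simp
next
  case (Suc r)
  have X0: "X i 0 = 0" for i
    using module_hom.zero[OF Vector_Spaces.linear.axioms(3)[OF Suc.prems(1)]] .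
  have kernels: "Suc k * dim {v \<in> U (Suc k). X r v = 0} \<le> (k + r) * dim {v \<in> U k. X r v = 0}"
    if U: "\<And>k. subspace (U k)" "\<And>k. finspan span (U k)"
      "\<And>i k. i < Suc r \<Longrightarrow> X i ` U (Suc k) \<subseteq> U k"
      "\<And>i j k v. v \<in> U k \<Longrightarrow> X i (X j v) = X j (X i v)"
      "\<And>k v. v \<in> U (Suc k) \<Longrightarrow> (\<And>i. i < Suc r \<Longrightarrow> X i v = 0) \<Longrightarrow> v = 0" for U k
  proof (rule Suc.IH[where U = "\<lambda>k. {v \<in> U k. X r v = 0}"])
    show "Vector_Spaces.linear scale scale (X i)" for i by (rule Suc.prems(1))
    show "subspace {v \<in> U k. X r v = 0}" for k
      using rank_nullity_linear(4)[OF U(1,2) Suc.prems(1)] .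
    show "finspan span {v \<in> U k. X r v = 0}" for k by (rule fin_dim_subset[OF U(2)[of k]]) auto
    show "X i ` {v \<in> U (Suc k). X r v = 0} \<subseteq> {v \<in> U k. X r v = 0}" if "i < r" for i k
    proof
      fix y assume "y \<in> X i ` {v \<in> U (Suc k). X r v = 0}"
      then obtain v where v: "v \<in> U (Suc k)" "X r v = 0" "y = X i v" by blast
      have "X r (X i v) = 0" using U(4)[OF v(1), of r i] v(2) X0 by simp
      then show "y \<in> {v \<in> U k. X r v = 0}" using v U(3)[of i k] that by auto
    qed
    show "X i (X j v) = X j (X i v)" if "v \<in> {v \<in> U k. X r v = 0}" for i j k v
      using U(4) that by blast
    show "v = 0" if "v \<in> {v \<in> U (Suc k). X r v = 0}" "\<And>i. i < r \<Longrightarrow> X i v = 0" for k v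
      proof (rule U(5)[of v k])
      show "X i v = 0" if "i < Suc r" for i
        using \<open>v \<in> {v \<in> U (Suc k). X r v = 0}\<close> \<open>\<And>i. i < r \<Longrightarrow> X i v = 0\<close>[of i] that
        by (cases "i = r") auto
    qed (use that in simp)
  qed
  show ?case using Suc.prems(2-)
  proof (induction k arbitrary: U)
    case (0 U)
    let ?K = "\<lambda>k. {v \<in> U k. X r v = 0}"
    have K: "Suc 0 * dim (?K (Suc 0)) \<le> (0 + r) * dim (?K 0)"
      by (rule kernels[of U, OF 0])
    have d: "dim (U (Suc 0)) = dim (?K (Suc 0)) + dim (X r ` U (Suc 0))"
      by (rule rank_nullity_linear(1)[OF 0(1,2) Suc.prems(1)])
    have "dim (?K 0) \<le> dim (U 0)"
      by (rule dim_mono_fin[OF 0(2)]) auto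
    then have "r * dim (?K 0) \<le> r * dim (U 0)" by (rule mult_le_mono2)
    moreover have "dim (X r ` U (Suc 0)) \<le> dim (U 0)"
      using 0(3)[of r 0] by (intro dim_mono_fin[OF 0(2)]) auto
    ultimately show ?case using K d by (simp only: add_0 mult_Suc mult_0)
  next
    case (Suc k U)
    note U = Suc.prems
    let ?K = "\<lambda>k. {v \<in> U k. X r v = 0}"
    let ?V = "\<lambda>k. X r ` U (Suc k)"
    have K: "Suc (Suc k) * dim (?K (Suc (Suc k))) \<le> (Suc k + r) * dim (?K (Suc k))"
      by (rule kernels[of U, OF U])
    have VU: "?V k \<subseteq> U k" for k
      using U(3)[of r k] by auto
    have V: "Suc k * dim (?V (Suc k)) \<le> (k + Suc r) * dim (?V k)"
    proof (rule Suc.IH)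
      show "subspace (?V k)" for k
        by (rule rank_nullity_linear(2)[OF U(1,2) \<open>\<And>i. Vector_Spaces.linear scale scale (X i)\<close>])
      show "finspan span (?V k)" for k
        by (rule rank_nullity_linear(3)[OF U(1,2) \<open>\<And>i. Vector_Spaces.linear scale scale (X i)\<close>])
      show "X i ` ?V (Suc k) \<subseteq> ?V k" if "i < Suc r" for i k
      proof
        fix y assume "y \<in> X i ` ?V (Suc k)"
        then obtain v where v: "v \<in> U (Suc (Suc k))" "y = X i (X r v)" by blast
        then have "y = X r (X i v)" "X i v \<in> U (Suc k)" using U(4)[OF v(1)] U(3)[OF that] by blast+
        then show "y \<in> ?V k" by blast
      qed
      show "X i (X j v) = X j (X i v)" if "v \<in> ?V k" for i j k v
        using U(4) VU that by blast
      show "v = 0" if "v \<in> ?V (Suc k)" "\<And>i. i < Suc r \<Longrightarrow> X i v = 0" for k v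
        using U(5) VU that by blast
    qed
    have d2: "dim (U (Suc (Suc k))) = dim (?K (Suc (Suc k))) + dim (?V (Suc k))"
      by (rule rank_nullity_linear(1)[OF U(1,2) \<open>\<And>i. Vector_Spaces.linear scale scale (X i)\<close>])
    have d1: "dim (U (Suc k)) = dim (?K (Suc k)) + dim (?V k)"
      by (rule rank_nullity_linear(1)[OF U(1,2) \<open>\<And>i. Vector_Spaces.linear scale scale (X i)\<close>])
    have dV: "dim (?V (Suc k)) \<le> dim (U (Suc k))"
      by (rule dim_mono_fin[OF U(2) VU])
    \<comment> \<open>One of the \<open>k + 2\<close> copies of the dimension of the image is split
      off. The others fall under the induction hypothesis for the images; the single copy is bounded
      by \<open>dim (U (Suc k))\<close>, which raises the factor from \<open>k + r + 1\<close> to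
      \<open>k + r + 2\<close>.\<close>
    have "Suc (Suc k) * dim (U (Suc (Suc k))) =
        Suc (Suc k) * dim (?K (Suc (Suc k))) + Suc k * dim (?V (Suc k)) + dim (?V (Suc k))"
      unfolding d2 by (simp add: algebra_simps)
    also have "\<dots> \<le> (Suc k + r) * dim (?K (Suc k)) + (k + Suc r) * dim (?V k) + dim (U (Suc k))"
      using K V dV by linarith
    also have "\<dots> = (Suc k + Suc r) * dim (U (Suc k))"
      unfolding d1 by (simp add: algebra_simps)
    finally show ?case .
  qed
qed

end

section \<open>Polynomials\<close>

abbreviation lkp :: "('a \<Rightarrow>\<^sub>0 'b::zero) \<Rightarrow> 'a \<Rightarrow> 'b" where "lkp \<equiv> Poly_Mapping.lookup"
abbreviation keys :: "('a \<Rightarrow>\<^sub>0 'b::zero) \<Rightarrow> 'a set" where "keys \<equiv> Poly_Mapping.keys"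
abbreviation ev :: "nat \<Rightarrow> nat \<Rightarrow>\<^sub>0 nat" where "ev k \<equiv> Poly_Mapping.single k (Suc 0)"

definition var :: "nat \<Rightarrow> 'k::field mpoly" where
  "var k = Poly_Mapping.single (ev k) 1"

definition scal :: "'k::field \<Rightarrow> 'k mpoly \<Rightarrow> 'k mpoly" where
  "scal c p = Poly_Mapping.single 0 c * p"

abbreviation polys :: "nat \<Rightarrow> 'k::field mpoly set" where
  "polys r \<equiv> carrier (mpoly_ring r)"

lemma mem_polys: "p \<in> polys r \<longleftrightarrow> (\<forall>m. lkp p m \<noteq> 0 \<longrightarrow> keys m \<subseteq> {..<r})"
  by (auto simp: mpoly_ring_def in_keys_iff)

lemma mem_forms: "p \<in> forms r d \<longleftrightarrow>
    (\<forall>m. lkp p m \<noteq> 0 \<longrightarrow> keys m \<subseteq> {..<r} \<and> int (mono_degree m) = d)"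
  by (auto simp: forms_def mem_polys in_keys_iff)

lemma keys_add_nat: "keys (m + n) = keys m \<union> keys (n :: nat \<Rightarrow>\<^sub>0 nat)"
  by (auto simp: in_keys_iff lookup_add)

lemma mono_degree_superset:
  assumes "finite A" "keys m \<subseteq> A"
  shows "mono_degree m = (\<Sum>x\<in>A. lkp m x)"
  unfolding mono_degree_def using assms
  by (intro sum.mono_neutral_left) (auto simp: in_keys_iff)

lemma mono_degree_add: "mono_degree (m + n) = mono_degree m + mono_degree n"
proof -
  let ?A = "keys m \<union> keys n"
  have "mono_degree (m + n) = (\<Sum>x\<in>?A. lkp (m + n) x)"
    by (rule mono_degree_superset) (auto simp: keys_add_nat)
  also have "\<dots> = (\<Sum>x\<in>?A. lkp m x) + (\<Sum>x\<in>?A. lkp n x)"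
    by (simp add: lookup_add sum.distrib)
  also have "\<dots> = mono_degree m + mono_degree n"
    using mono_degree_superset[of ?A m] mono_degree_superset[of ?A n] by simp
  finally show ?thesis .
qed

lemma mono_degree_single [simp]: "mono_degree (Poly_Mapping.single k n) = n"
  by (simp add: mono_degree_def)

lemma mono_degree_0 [simp]: "mono_degree 0 = 0"
  by (simp add: mono_degree_def)

lemma mono_degree_eq_0 [simp]: "mono_degree m = 0 \<longleftrightarrow> m = 0"
proof
  assume "mono_degree m = 0"
  then show "m = 0"
    by (intro poly_mapping_eqI) (auto simp: mono_degree_def in_keys_iff)
qed simp

lemma lookup_monomial_mult:
  fixes p :: "'k::field mpoly"
  shows "lkp (Poly_Mapping.single t c * p) (t + m) = c * lkp p m"
    and "\<nexists>n. m' = t + n \<Longrightarrow> lkp (Poly_Mapping.single t c * p) m' = 0"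
proof -
  have *: "lkp (Poly_Mapping.single t c * p) k = c * Sum_any (\<lambda>q. lkp p q when k = t + q)" for k
  proof -
    have "lkp (Poly_Mapping.single t c * p) k =
        Sum_any (\<lambda>l. (c * Sum_any (\<lambda>q. lkp p q when k = l + q)) when l = t)"
      unfolding lookup_mult by (rule Sum_any.cong) (auto simp: lookup_single when_def)
    then show ?thesis by (simp del: when_mult mult_when)
  qed
  have "Sum_any (\<lambda>q. lkp p q when t + m = t + q) = lkp p m"
    by (simp add: eq_commute)
  then show "lkp (Poly_Mapping.single t c * p) (t + m) = c * lkp p m"
    using *[of "t + m"] by simp
  show "lkp (Poly_Mapping.single t c * p) m' = 0" if "\<nexists>n. m' = t + n"
    unfolding * using that by simp
qed

lemma lookup_scal [simp]: "lkp (scal c p) m = c * lkp p m"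
  using lookup_monomial_mult(1)[of 0 c p m] by (simp add: scal_def)

lemma scal_mult_right: "scal c (p * q) = p * scal c q"
  by (simp add: scal_def algebra_simps)

interpretation mp: vector_space scal
  by unfold_locales
    (auto intro!: poly_mapping_eqI simp: lookup_add algebra_simps)

lemma ev_split: "lkp m k \<noteq> 0 \<Longrightarrow> m = ev k + (m - ev k)"
  by (rule poly_mapping_eqI) (auto simp: lookup_add lookup_minus lookup_single when_def)

lemma lookup_var_mult:
  "lkp (var k * p) m = (if lkp m k = 0 then 0 else lkp p (m - ev k))"
proof (cases "lkp m k = 0")
  case True
  have "\<nexists>n. m = ev k + n"
    using True by (auto simp: lookup_add)
  then show ?thesis using True lookup_monomial_mult(2) unfolding var_def by simp
next
  case False
  then show ?thesis
    using lookup_monomial_mult(1)[of "ev k" 1 p "m - ev k"] ev_split[of m k]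
    unfolding var_def by simp
qed

lemma polys_closed [simp, intro]:
  fixes p q :: "'k::field mpoly"
  shows "0 \<in> polys r" "1 \<in> polys r" "p \<in> polys r \<Longrightarrow> q \<in> polys r \<Longrightarrow> p + q \<in> polys r"
    "p \<in> polys r \<Longrightarrow> q \<in> polys r \<Longrightarrow> p - q \<in> polys r"
    "p \<in> polys r \<Longrightarrow> - p \<in> polys r"
    "p \<in> polys r \<Longrightarrow> q \<in> polys r \<Longrightarrow> p * q \<in> polys r"
    "p \<in> polys r \<Longrightarrow> scal c p \<in> polys r"
    "Poly_Mapping.single 0 c \<in> polys r"
    "k < r \<Longrightarrow> var k \<in> polys r"
proof -
  show "p * q \<in> polys r" if "p \<in> polys r" "q \<in> polys r"
  proof -
    have "keys m \<subseteq> {..<r}" if "m \<in> keys (p * q)" for m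
    proof -
      obtain a b where "a \<in> keys p" "b \<in> keys q" "m = a + b"
        using keys_mult \<open>m \<in> keys (p * q)\<close> by blast
      then show ?thesis
        using \<open>p \<in> polys r\<close> \<open>q \<in> polys r\<close> by (auto simp: mpoly_ring_def keys_add_nat)
    qed
    then show ?thesis by (auto simp: mpoly_ring_def)
  qed
  show "p - q \<in> polys r" if "p \<in> polys r" "q \<in> polys r"
    using that unfolding mem_polys lookup_minus by (metis diff_self diff_zero)
  show "p + q \<in> polys r" if "p \<in> polys r" "q \<in> polys r"
    using that unfolding mem_polys lookup_add by (metis add_0)
qed (auto simp: mem_polys lookup_one lookup_single when_def var_def)

lemma forms_subset_polys: "forms r d \<subseteq> polys r"
  by (auto simp: forms_def)

lemma forms_neg: "d < 0 \<Longrightarrow> forms r d = {0}"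
proof -
  assume "d < 0"
  have "p = 0" if "p \<in> forms r d" for p :: "'a mpoly"
    using that \<open>d < 0\<close> by (intro poly_mapping_eqI) (force simp: mem_forms)
  then show ?thesis by (auto simp: mem_forms)
qed

lemma subspace_forms [simp]: "mp.subspace (forms r d)"
proof (rule mp.subspaceI)
  show "p + q \<in> forms r d" if "p \<in> forms r d" "q \<in> forms r d" for p q :: "'a mpoly"
    using that unfolding mem_forms lookup_add by (metis add_0)
qed (auto simp: mem_forms)

lemma subspace_polys [simp]: "mp.subspace (polys r)"
  by (rule mp.subspaceI) auto

lemma forms_mult:
  assumes "p \<in> forms r a" "q \<in> forms r b"
  shows "p * q \<in> forms r (a + b)"
proof -
  have "int (mono_degree m) = a + b" if "m \<in> keys (p * q)" for m
  proof -
    obtain x y where "x \<in> keys p" "y \<in> keys q" "m = x + y"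
      using subsetD[OF keys_mult \<open>m \<in> keys (p * q)\<close>] by blast
    then show ?thesis
      using assms by (auto simp: forms_def mono_degree_add)
  qed
  then show ?thesis using assms by (auto simp: forms_def)
qed

lemma var_forms [simp]: "k < r \<Longrightarrow> var k \<in> forms r 1"
  by (auto simp: mem_forms var_def lookup_single when_def)

lemma one_forms [simp]: "1 \<in> forms r 0"
  by (auto simp: mem_forms lookup_one when_def)

lemma lookup_0_forms: "p \<in> forms r d \<Longrightarrow> d \<noteq> 0 \<Longrightarrow> lkp p 0 = 0"
  by (force simp: mem_forms)

lemma forms_0_scalar: "p \<in> forms r 0 \<Longrightarrow> p = scal (lkp p 0) 1"
  by (rule poly_mapping_eqI) (auto simp: mem_forms lookup_one when_def)

subsection \<open>Division by a variable\<close>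

text \<open>The quotient of division by one variable; \<open>remX\<close> is the remainder, which
  amounts to setting the variable to 0. These explicit operators take the place of regular-sequence
  arguments in the Koszul relations and drive the induction on the number of variables.\<close>

definition divX :: "nat \<Rightarrow> 'k::field mpoly \<Rightarrow> 'k mpoly" where
  "divX k p = Poly_Mapping.map_key (\<lambda>m. m + ev k) p"

definition remX :: "nat \<Rightarrow> 'k::field mpoly \<Rightarrow> 'k mpoly" where
  "remX k p = Poly_Mapping.mapp (\<lambda>m c. if lkp m k = 0 then c else 0) p"

lemma lookup_divX [simp]: "lkp (divX k p) m = lkp p (m + ev k)"
  unfolding divX_def by (subst map_key.rep_eq) (auto intro: injI)

lemma lookup_remX [simp]: "lkp (remX k p) m = (if lkp m k = 0 then lkp p m else 0)"
  unfolding remX_def by (auto simp: lookup_mapp when_def in_keys_iff)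

lemma div_rem_eq: "p = var k * divX k p + remX k p"
proof (rule poly_mapping_eqI)
  fix m
  show "lkp p m = lkp (var k * divX k p + remX k p) m"
    using ev_split[of m k] by (auto simp: lookup_add lookup_var_mult add.commute)
qed

lemma divX_0 [simp]: "divX k 0 = 0"
  and remX_add: "remX k (p + q) = remX k p + remX k q"
  and remX_0 [simp]: "remX k 0 = 0"
  and remX_scal: "remX k (scal c p) = scal c (remX k p)"
  by (auto intro!: poly_mapping_eqI simp: lookup_add lookup_minus)

lemma divX_var_same [simp]: "divX k (var k * p) = p"
  by (rule poly_mapping_eqI) (auto simp: lookup_var_mult lookup_add)

lemma remX_var_same [simp]: "remX k (var k * p) = 0"
  by (rule poly_mapping_eqI) (auto simp: lookup_var_mult)

lemma ev_diff_commute: "k \<noteq> l \<Longrightarrow> m + ev k - ev l = (m - ev l) + ev k"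
  by (rule poly_mapping_eqI) (auto simp: lookup_add lookup_minus lookup_single when_def)

lemma remX_var_other: "k \<noteq> l \<Longrightarrow> remX k (var l * p) = var l * remX k p"
  by (rule poly_mapping_eqI) (auto simp: lookup_var_mult lookup_minus lookup_single)

lemma var_mult_cancel: "var k * p = var k * q \<Longrightarrow> p = q"
  by (metis divX_var_same)

lemma divX_polys [simp, intro]: "p \<in> polys r \<Longrightarrow> divX k p \<in> polys r"
  by (force simp: mem_polys keys_add_nat)

lemma remX_polys [simp, intro]: "p \<in> polys r \<Longrightarrow> remX k p \<in> polys r"
  by (auto simp: mem_polys)

lemma divX_forms: "p \<in> forms r d \<Longrightarrow> divX k p \<in> forms r (d - 1)"
  by (force simp: mem_forms keys_add_nat mono_degree_add)

lemma keys_less: "keys m \<subseteq> {..<Suc r} \<Longrightarrow> lkp m r = 0 \<Longrightarrow> keys m \<subseteq> {..<r}"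
  by (auto simp: in_keys_iff subset_iff less_Suc_eq)

lemma remX_last_forms: "p \<in> forms (Suc r) d \<Longrightarrow> remX r p \<in> forms r d"
  unfolding mem_forms lookup_remX using keys_less by (metis (full_types))

lemma forms_Suc: "forms r d \<subseteq> forms (Suc r) d"
  by (auto simp: mem_forms) (meson lessThan_iff less_SucI subsetD)

lemma remX_of_forms:
  assumes "p \<in> forms r d"
  shows "remX r p = p"
proof (rule poly_mapping_eqI)
  fix m
  have "lkp m r = 0" if "lkp p m \<noteq> 0"
    using assms that by (auto simp: mem_forms subset_iff in_keys_iff)
  then show "lkp (remX r p) m = lkp p m" by (cases "lkp p m = 0") auto
qed

text \<open>Setting the variable \<open>l\<close> to 0 kills the right-hand side of the relation, so
  \<open>remX l p\<close> vanishes and \<open>p\<close> is divisible by that variable.\<close>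

lemma koszul_two:
  assumes "k \<noteq> l" "var k * p = var l * q"
  shows "p = var l * divX l p" "q = var k * divX l p"
proof -
  have "var k * remX l p = remX l (var l * q)"
    using assms by (metis remX_var_other)
  then have "var k * remX l p = var k * 0" by simp
  then have "remX l p = 0" by (rule var_mult_cancel)
  then show p: "p = var l * divX l p" using div_rem_eq[of p l] by simp
  have "var l * q = var l * (var k * divX l p)"
    using assms(2) p by (metis mult.left_commute)
  then show "q = var k * divX l p" by (rule var_mult_cancel)
qed

text \<open>Modulo the variable \<open>i\<close> the relation involves only the remainders of
  \<open>b\<close> and \<open>c\<close>. Subtracting that part leaves a multiple of the variable
  \<open>i\<close>, which can be cancelled.\<close>

lemma koszul_three:
  assumes "i \<noteq> j" "i \<noteq> k" "j \<noteq> k" "var i * a + var j * b + var k * c = 0"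
  shows "a = - (var j * divX i b) - var k * divX i c"
proof -
  have "remX i (var i * a + var j * b + var k * c) = 0" using assms(4) by simp
  then have r: "var j * remX i b + var k * remX i c = 0"
    using assms(1-3) by (simp add: remX_add remX_var_other)
  have jb: "var j * b = var i * (var j * divX i b) + var j * remX i b"
    using arg_cong[OF div_rem_eq[of b i], of "(*) (var j)"]
    by (simp only: distrib_left mult.left_commute)
  have kc: "var k * c = var i * (var k * divX i c) + var k * remX i c"
    using arg_cong[OF div_rem_eq[of c i], of "(*) (var k)"]
    by (simp only: distrib_left mult.left_commute)
  have "var i * (a + var j * divX i b + var k * divX i c) =
      var i * a + var j * b + var k * c - (var j * remX i b + var k * remX i c)"
    unfolding jb kc by (simp add: algebra_simps)
  also have "\<dots> = var i * 0" using r assms(4) by simp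
  finally have "a + var j * divX i b + var k * divX i c = 0" by (rule var_mult_cancel)
  then show ?thesis by (simp add: algebra_simps eq_neg_iff_add_eq_0)
qed

text \<open>After three successive divisions only the constant term can remain.\<close>

lemma irrelevant_decomp:
  assumes "p \<in> polys 3" "lkp p 0 = 0"
  shows "p = var 0 * divX 0 p + var 1 * divX 1 (remX 0 p) + var 2 * divX 2 (remX 1 (remX 0 p))"
proof -
  have "remX 2 (remX 1 (remX 0 p)) = 0"
  proof (rule poly_mapping_eqI)
    fix m
    have "m = 0" if "lkp m 0 = 0" "lkp m 1 = 0" "lkp m 2 = 0" "lkp p m \<noteq> 0"
    proof (rule poly_mapping_eqI)
      fix x
      show "lkp m x = lkp 0 x"
      proof (cases "x < 3")
        case True
        then have "x = 0 \<or> x = 1 \<or> x = 2" by auto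
        then show ?thesis using that by auto
      next
        case False
        then show ?thesis using that(4) assms(1) by (force simp: mem_polys in_keys_iff)
      qed
    qed
    then show "lkp (remX 2 (remX 1 (remX 0 p))) m = lkp 0 m"
      using assms(2) by auto
  qed
  then show ?thesis
    using div_rem_eq[of p 0] div_rem_eq[of "remX 0 p" 1] div_rem_eq[of "remX 1 (remX 0 p)" 2]
    by (metis add.assoc add_0_right)
qed

subsection \<open>Dimension of the space of forms\<close>

lemma scal_in_span: "scal c p \<in> mp.span (insert p S)"
  by (simp add: mp.span_base mp.span_scale)

lemma forms_degree_0: "forms r 0 = mp.span {1 :: 'k::field mpoly}"
proof
  show "forms r 0 \<subseteq> mp.span {1 :: 'k mpoly}"
  proof
    fix p :: "'k mpoly" assume "p \<in> forms r 0"
    then have "p = scal (lkp p 0) 1" by (rule forms_0_scalar)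
    then show "p \<in> mp.span {1}" using scal_in_span[of "lkp p 0" 1 "{}"] by simp
  qed
  show "mp.span {1 :: 'k mpoly} \<subseteq> forms r 0"
    by (rule mp.span_minimal) auto
qed

lemma forms_no_variables: "d \<noteq> 0 \<Longrightarrow> forms 0 d = {0 :: 'k::field mpoly}"
proof
  assume "d \<noteq> 0"
  then have "p = 0" if "p \<in> forms 0 d" for p :: "'k mpoly"
    using that by (intro poly_mapping_eqI) (auto simp: mem_forms)
  then show "forms 0 d \<subseteq> {0 :: 'k mpoly}" by blast
qed (auto simp: mem_forms)

lemma linear_mult_left: "Vector_Spaces.linear scal scal ((*) (q :: 'k::field mpoly))"
  unfolding Vector_Spaces.linear_iff using mp.vector_space_axioms by (auto simp: distrib_left scal_mult_right)

lemma linear_remX: "Vector_Spaces.linear scal scal (remX k :: 'k::field mpoly \<Rightarrow> _)"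
  unfolding Vector_Spaces.linear_iff using mp.vector_space_axioms by (auto simp: remX_add remX_scal)

lemma finspan_forms_nat: "finspan mp.span (forms r (int d) :: 'k::field mpoly set)"
proof (induction r arbitrary: d)
  case 0
  show ?case
    unfolding finspan_def
    by (intro exI[of _ "{1}"], cases "d = 0") (simp_all add: forms_no_variables forms_degree_0 mp.span_zero)
next
  case (Suc r)
  show ?case
  proof (induction d)
    case 0
    show ?case unfolding finspan_def by (intro exI[of _ "{1}"]) (simp add: forms_degree_0)
  next
    case (Suc d)
    obtain W where W: "finite W" "forms (Suc r) (int d) \<subseteq> mp.span (W :: 'k mpoly set)"
      using Suc.IH unfolding finspan_def by blast
    obtain W' where W': "finite W'" "forms r (int (Suc d)) \<subseteq> mp.span (W' :: 'k mpoly set)"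
      using \<open>\<And>d. finspan mp.span (forms r (int d))\<close> unfolding finspan_def by blast
    let ?T = "(*) (var r) ` W \<union> W'"
    interpret P: vector_space_pair "scal :: 'k \<Rightarrow> _" scal by unfold_locales
    have lin: "Vector_Spaces.linear scal scal ((*) (var r :: 'k mpoly))"
      by (rule linear_mult_left)
    have "p \<in> mp.span ?T" if "p \<in> forms (Suc r) (int (Suc d))" for p :: "'k mpoly"
    proof -
      have "divX r p \<in> mp.span W"
        using W(2) divX_forms[OF that, of r] by auto
      then have "var r * divX r p \<in> mp.span ((*) (var r) ` W)"
        using P.linear_span_image[OF lin, of W] by blast
      then have "var r * divX r p \<in> mp.span ?T"
        using mp.span_mono[of _ ?T] by blast
      moreover have "remX r p \<in> mp.span ?T"
        using W'(2) remX_last_forms[OF that] mp.span_mono[of W' ?T] by blast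
      ultimately show ?thesis by (subst div_rem_eq[of p r]) (rule mp.span_add)
    qed
    then show ?case unfolding finspan_def using W(1) W'(1) by (intro exI[of _ ?T]) auto
  qed
qed

lemma finspan_forms [simp]: "finspan mp.span (forms r d :: 'k::field mpoly set)"
proof (cases "d < 0")
  case False
  then show ?thesis using finspan_forms_nat[of r "nat d"] by simp
qed (simp add: forms_neg)

text \<open>Setting the last variable to 0 maps onto the forms in the other variables, and the
  kernel is that variable times the forms of one degree less; the dimensions thus obey Pascal's
  rule.\<close>

lemma dim_forms: "mp.dim (forms r (int d) :: 'k::field mpoly set) = num_monos r d"
proof (induction r arbitrary: d)
  have d0: "mp.dim (forms r 0 :: 'k mpoly set) = 1" for r
    unfolding forms_degree_0 using mp.dim_span_eq_card_independent[of "{1 :: 'k mpoly}"] by simp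
  {
    case 0
    show ?case
      using d0 by (cases "d = 0") (auto simp: num_monos_def forms_no_variables)
  next
    case (Suc r)
    show ?case
    proof (induction d)
      case 0
      show ?case using d0 by (simp add: num_monos_def)
    next
      case (Suc d)
      let ?V = "forms (Suc r) (int (Suc d)) :: 'k mpoly set"
      let ?W = "forms (Suc r) (int d) :: 'k mpoly set"
      have "mp.dim ?V = mp.dim {v \<in> ?V. remX r v = 0} + mp.dim (remX r ` ?V)"
        by (rule mp.rank_nullity_linear(1)) (simp_all add: linear_remX del: of_nat_Suc)
      moreover have "remX r ` ?V = forms r (int (Suc d))"
      proof
        show "remX r ` ?V \<subseteq> forms r (int (Suc d))" using remX_last_forms by blast
        show "forms r (int (Suc d)) \<subseteq> remX r ` ?V"
        proof
          fix p :: "'k mpoly" assume p: "p \<in> forms r (int (Suc d))"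
          have "p = remX r p" using remX_of_forms[OF p] by simp
          then show "p \<in> remX r ` ?V" using p forms_Suc by blast
        qed
      qed
      moreover have "{v \<in> ?V. remX r v = 0} = (*) (var r) ` ?W"
      proof
        show "{v \<in> ?V. remX r v = 0} \<subseteq> (*) (var r) ` ?W"
        proof
          fix v assume v: "v \<in> {v \<in> ?V. remX r v = 0}"
          then have "v = var r * divX r v" using div_rem_eq[of v r] by simp
          moreover have "divX r v \<in> ?W" using v divX_forms[of v "Suc r" "int (Suc d)" r] by simp
          ultimately show "v \<in> (*) (var r) ` ?W" by blast
        qed
        show "(*) (var r) ` ?W \<subseteq> {v \<in> ?V. remX r v = 0}"
          using forms_mult[OF var_forms[of r "Suc r"], of _ "int d"] by (auto simp: add.commute)
      qed
      moreover have "mp.dim ?W = mp.dim {v \<in> ?W. var r * v = 0} + mp.dim ((*) (var r) ` ?W)"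
        by (rule mp.rank_nullity_linear(1)) (simp_all add: linear_mult_left)
      moreover have "{v \<in> ?W. var r * v = 0} = {0}"
        using var_mult_cancel[of r _ 0] mp.subspace_0[OF subspace_forms] by auto
      ultimately have "mp.dim ?V = num_monos (Suc r) d + num_monos r (Suc d)"
        using Suc.IH \<open>\<And>d. mp.dim (forms r (int d)) = num_monos r d\<close>[of "Suc d"] by simp
      then show ?case by (simp add: num_monos_def)
    qed
  }
qed

section \<open>Graded free modules\<close>


text \<open>Unlike \<open>hom_component\<close> this takes an integer degree: coordinate
  \<open>a\<close> of an element of degree \<open>d\<close> in a shifted module has degree
  \<open>d - D ! a\<close>, which may be negative.\<close>

definition hcomp :: "int \<Rightarrow> 'k::field mpoly \<Rightarrow> 'k mpoly" where
  "hcomp d p = Poly_Mapping.mapp (\<lambda>m c. if int (mono_degree m) = d then c else 0) p"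

lemma lookup_hcomp [simp]: "lkp (hcomp d p) m = (if int (mono_degree m) = d then lkp p m else 0)"
  unfolding hcomp_def by (auto simp: lookup_mapp when_def in_keys_iff)

lemma hom_component_eq_hcomp: "hom_component n p = hcomp (int n) p"
  unfolding hom_component_def hcomp_def by simp

lemma hcomp_add: "hcomp d (p + q) = hcomp d p + hcomp d q"
  and hcomp_0 [simp]: "hcomp d 0 = 0"
  by (auto intro!: poly_mapping_eqI simp: lookup_add)

lemma hcomp_forms [simp, intro]: "p \<in> polys r \<Longrightarrow> hcomp d p \<in> forms r d"
  by (auto simp: mem_forms mem_polys)

lemma hcomp_of_form: "p \<in> forms r d \<Longrightarrow> hcomp e p = (if e = d then p else 0)"
  by (rule poly_mapping_eqI) (auto simp: mem_forms)

lemma hcomp_neg: "d < 0 \<Longrightarrow> hcomp d p = 0"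
  by (rule poly_mapping_eqI) auto

lemma sum_hcomp:
  assumes "finite S" "(\<lambda>m. int (mono_degree m)) ` keys p \<subseteq> S"
  shows "p = (\<Sum>d\<in>S. hcomp d p)"
proof (rule poly_mapping_eqI)
  fix m
  show "lkp p m = lkp (\<Sum>d\<in>S. hcomp d p) m"
  proof (cases "lkp p m = 0")
    case True
    then have "lkp (hcomp d p) m = 0" for d by simp
    then show ?thesis using True unfolding lookup_sum by simp
  next
    case False
    then have "int (mono_degree m) \<in> S" using assms(2) by (auto simp: in_keys_iff)
    then show ?thesis using assms(1) by (simp add: lookup_sum)
  qed
qed

definition fscal :: "'k::field \<Rightarrow> (nat \<Rightarrow> 'k mpoly) \<Rightarrow> nat \<Rightarrow> 'k mpoly" where
  "fscal c v = (\<lambda>a. scal c (v a))"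

interpretation fn: vector_space fscal
  by unfold_locales (auto simp: fscal_def mp.scale_right_distrib mp.scale_left_distrib)

abbreviation vsmult :: "'k::field mpoly \<Rightarrow> (nat \<Rightarrow> 'k mpoly) \<Rightarrow> nat \<Rightarrow> 'k mpoly" (infixr "\<star>" 75) where
  "p \<star> v \<equiv> (\<lambda>a. p * v a)"

lemma fscal_eq: "fscal c v = Poly_Mapping.single 0 c \<star> v"
  by (simp add: fscal_def scal_def)

lemma free_mod_closed [simp, intro]:
  "(0 :: nat \<Rightarrow> 'k::field mpoly) \<in> free_mod r D"
  "v \<in> free_mod r D \<Longrightarrow> w \<in> free_mod r D \<Longrightarrow> v + w \<in> free_mod r D"
  "v \<in> free_mod r D \<Longrightarrow> w \<in> free_mod r D \<Longrightarrow> v - w \<in> free_mod r D"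
  "v \<in> free_mod r D \<Longrightarrow> - v \<in> free_mod r D"
  "p \<in> polys r \<Longrightarrow> v \<in> free_mod r D \<Longrightarrow> p \<star> v \<in> free_mod r D"
  "v \<in> free_mod r D \<Longrightarrow> fscal c v \<in> free_mod r D"
  by (auto simp: free_mod_def fscal_def)

lemma subspace_piece [simp]: "fn.subspace (free_mod_piece r D d)"
  by (rule fn.subspaceI)
    (auto simp: free_mod_piece_def fscal_def free_mod_def mp.subspace_0 mp.subspace_add mp.subspace_scale)

lemma piece_subset: "free_mod_piece r D d \<subseteq> free_mod r D"
  by (auto simp: free_mod_piece_def)

definition unitv :: "nat \<Rightarrow> 'k::field mpoly \<Rightarrow> nat \<Rightarrow> 'k mpoly" where
  "unitv a p = (\<lambda>b. if b = a then p else 0)"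

lemma linear_unitv: "Vector_Spaces.linear scal fscal (unitv a :: 'k::field mpoly \<Rightarrow> _)"
  unfolding Vector_Spaces.linear_iff using mp.vector_space_axioms fn.vector_space_axioms
  by (auto simp: unitv_def fscal_def)

lemma unitv_piece: "a < length D \<Longrightarrow> p \<in> forms r (d - D ! a) \<Longrightarrow> unitv a p \<in> free_mod_piece r D d"
  using forms_subset_polys[of r "d - D ! a"] mp.subspace_0[OF subspace_forms]
  by (auto simp: free_mod_piece_def free_mod_def unitv_def)

lemma sum_fun_apply: "(sum f A) b = (\<Sum>a\<in>A. f a b)"
  by (induction A rule: infinite_finite_induct) auto

lemma free_mod_sum_unitv: "v \<in> free_mod r D \<Longrightarrow> v = (\<Sum>a<length D. unitv a (v a))"
proof
  fix b assume v: "v \<in> free_mod r D"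
  have "(\<Sum>a<length D. unitv a (v a)) b = (\<Sum>a<length D. unitv a (v a) b)"
    by (rule sum_fun_apply)
  also have "\<dots> = v b"
    unfolding unitv_def using v by (simp add: free_mod_def)
  finally show "v b = (\<Sum>a<length D. unitv a (v a)) b" by simp
qed

lemma finspan_piece [simp]: "finspan fn.span (free_mod_piece r D d :: (nat \<Rightarrow> 'k::field mpoly) set)"
proof -
  interpret P: vector_space_pair "scal :: 'k \<Rightarrow> _" fscal by unfold_locales
  have "\<exists>W. finite W \<and> forms r e \<subseteq> mp.span (W :: 'k mpoly set)" for e
    using finspan_forms[of r e] unfolding finspan_def by blast
  then obtain W :: "int \<Rightarrow> 'k mpoly set" where W: "finite (W e)" "forms r e \<subseteq> mp.span (W e)" for e
    by metis
  let ?T = "\<Union>a<length D. unitv a ` W (d - D ! a)"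
  have "v \<in> fn.span ?T" if v: "v \<in> free_mod_piece r D d" for v
  proof -
    have "unitv a (v a) \<in> fn.span ?T" if "a < length D" for a
    proof -
      have "v a \<in> mp.span (W (d - D ! a))" using v that W(2) by (auto simp: free_mod_piece_def)
      then have "unitv a (v a) \<in> fn.span (unitv a ` W (d - D ! a))"
        using P.linear_span_image[OF linear_unitv, of a "W (d - D ! a)"] by blast
      then show ?thesis using fn.span_mono[of "unitv a ` W (d - D ! a)" ?T] that by blast
    qed
    then have "(\<Sum>a<length D. unitv a (v a)) \<in> fn.span ?T" by (intro fn.span_sum) auto
    moreover have "v \<in> free_mod r D" using v piece_subset by blast
    ultimately show ?thesis using free_mod_sum_unitv[of v r D] by argo
  qed
  then show ?thesis unfolding finspan_def using W(1) by (intro exI[of _ ?T]) auto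
qed

definition num_forms :: "nat \<Rightarrow> int \<Rightarrow> nat" where
  "num_forms r d = (if d < 0 then 0 else num_monos r (nat d))"

lemma dim_forms_int: "mp.dim (forms r d :: 'k::field mpoly set) = num_forms r d"
proof (cases "d < 0")
  case False
  then show ?thesis using dim_forms[of r "nat d", where 'k = 'k] by (simp add: num_forms_def)
qed (simp add: forms_neg num_forms_def)

lemma piece_Nil: "free_mod_piece r [] d = {0}"
  by (auto simp: free_mod_piece_def free_mod_def)

text \<open>Rank-nullity for the projection onto the last coordinate: its kernel is the piece for
  the list without the last shift.\<close>

lemma dim_piece:
  "fn.dim (free_mod_piece r D d :: (nat \<Rightarrow> 'k::field mpoly) set) = (\<Sum>j\<leftarrow>D. num_forms r (d - j))"
proof (induction D rule: rev_induct)
  case Nil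
  show ?case by (simp add: piece_Nil)
next
  case (snoc j D)
  interpret P: vector_space_pair fscal "scal :: 'k \<Rightarrow> _" by unfold_locales
  let ?V = "free_mod_piece r (D @ [j]) d :: (nat \<Rightarrow> 'k mpoly) set"
  let ?n = "length D"
  have "fn.dim ?V = fn.dim {v \<in> ?V. v ?n = 0} + mp.dim ((\<lambda>v. v ?n) ` ?V)"
    by (rule P.rank_nullity) (auto simp: fscal_def)
  moreover have "{v \<in> ?V. v ?n = 0} = free_mod_piece r D d"
  proof
    show "{v \<in> ?V. v ?n = 0} \<subseteq> free_mod_piece r D d"
    proof
      fix v assume v: "v \<in> {v \<in> ?V. v ?n = 0}"
      have "v a = 0" if "a \<ge> ?n" for a
        using v that by (cases "a = ?n") (auto simp: free_mod_piece_def free_mod_def)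
      moreover have "v a \<in> forms r (d - D ! a)" "v a \<in> polys r" if "a < ?n" for a
      proof -
        have "v a \<in> forms r (d - (D @ [j]) ! a)" "v a \<in> polys r"
          using v that by (simp_all add: free_mod_piece_def free_mod_def)
        then show "v a \<in> forms r (d - D ! a)" "v a \<in> polys r"
          using that by (simp_all add: nth_append)
      qed
      ultimately show "v \<in> free_mod_piece r D d"
        by (auto simp: free_mod_piece_def free_mod_def)
    qed
    show "free_mod_piece r D d \<subseteq> {v \<in> ?V. v ?n = 0}"
      using mp.subspace_0[OF subspace_forms]
      by (auto simp: free_mod_piece_def free_mod_def nth_append less_Suc_eq)
  qed
  moreover have "(\<lambda>v. v ?n) ` ?V = forms r (d - j)"
  proof
    show "(\<lambda>v. v ?n) ` ?V \<subseteq> forms r (d - j)"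
      by (auto simp: free_mod_piece_def)
    show "forms r (d - j) \<subseteq> (\<lambda>v. v ?n) ` ?V"
    proof
      fix p :: "'k mpoly" assume "p \<in> forms r (d - j)"
      then have "unitv ?n p \<in> ?V" by (intro unitv_piece) auto
      moreover have "p = unitv ?n p ?n" by (simp add: unitv_def)
      ultimately show "p \<in> (\<lambda>v. v ?n) ` ?V" by blast
    qed
  qed
  ultimately show ?case using snoc.IH by (simp add: dim_forms_int)
qed

definition vcomp :: "int list \<Rightarrow> int \<Rightarrow> (nat \<Rightarrow> 'k::field mpoly) \<Rightarrow> nat \<Rightarrow> 'k mpoly" where
  "vcomp D d v = (\<lambda>a. if a < length D then hcomp (d - D ! a) (v a) else 0)"

lemma vcomp_piece: "v \<in> free_mod r D \<Longrightarrow> vcomp D d v \<in> free_mod_piece r D d"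
  using subsetD[OF forms_subset_polys hcomp_forms]
  by (auto simp: free_mod_piece_def free_mod_def vcomp_def)

lemma vcomp_add: "vcomp D d (v + w) = vcomp D d v + vcomp D d w"
  by (auto simp: vcomp_def hcomp_add)

lemma vcomp_0 [simp]: "vcomp D d 0 = 0"
  by (auto simp: vcomp_def)

lemma vcomp_sum: "vcomp D d (sum f A) = (\<Sum>i\<in>A. vcomp D d (f i))"
  by (induction A rule: infinite_finite_induct) (simp_all only: sum.infinite sum.empty sum.insert vcomp_add vcomp_0 simp_thms)

lemma vcomp_of_piece: "v \<in> free_mod_piece r D d \<Longrightarrow> vcomp D e v = (if e = d then v else 0)"
proof
  fix a assume v: "v \<in> free_mod_piece r D d"
  show "vcomp D e v a = (if e = d then v else 0) a"
  proof (cases "a < length D")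
    case True
    then have "v a \<in> forms r (d - D ! a)" using v by (auto simp: free_mod_piece_def)
    then show ?thesis using True hcomp_of_form[of "v a" r "d - D ! a"] by (auto simp: vcomp_def)
  next
    case False
    then show ?thesis using v by (auto simp: vcomp_def free_mod_piece_def free_mod_def)
  qed
qed

lemma sum_vcomp:
  assumes "v \<in> free_mod r D"
  obtains S where "finite S" "d \<in> S" "v = (\<Sum>e\<in>S. vcomp D e v)"
proof -
  \<comment> \<open>\<open>d\<close> is added even if \<open>v\<close> has no component of that
    degree, so that the summand of degree \<open>d\<close> can always be isolated.\<close>
  define S where "S = insert d (\<Union>a<length D. (\<lambda>m. int (mono_degree m) + D ! a) ` keys (v a))"
  have fin: "finite S" unfolding S_def by auto
  have "v = (\<Sum>e\<in>S. vcomp D e v)"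
  proof
    fix a
    have e: "(\<Sum>e\<in>S. vcomp D e v) a = (\<Sum>e\<in>S. vcomp D e v a)"
      by (rule sum_fun_apply)
    show "v a = (\<Sum>e\<in>S. vcomp D e v) a"
    proof (cases "a < length D")
      case True
      have "v a = (\<Sum>e\<in>(\<lambda>e. e - D ! a) ` S. hcomp e (v a))"
        using fin True unfolding S_def by (intro sum_hcomp) (force intro!: image_eqI)+
      also have "\<dots> = (\<Sum>e\<in>S. hcomp (e - D ! a) (v a))"
        by (subst sum.reindex) (auto simp: inj_on_def)
      finally show ?thesis unfolding e using True by (simp add: vcomp_def)
    next
      case False
      then show ?thesis unfolding e using assms by (simp add: vcomp_def free_mod_def)
    qed
  qed
  then show ?thesis using that[of S] fin by (simp add: S_def)
qed

section \<open>Homomorphisms of graded free modules\<close>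

context
  fixes r D E and f :: "(nat \<Rightarrow> 'k::field mpoly) \<Rightarrow> nat \<Rightarrow> 'k mpoly"
  assumes f: "graded_hom r D E f"
begin

lemma graded_hom_closed: "v \<in> free_mod r D \<Longrightarrow> f v \<in> free_mod r E"
  using f by (auto simp: graded_hom_def)

lemma graded_hom_piece: "v \<in> free_mod_piece r D d \<Longrightarrow> f v \<in> free_mod_piece r E d"
  using f unfolding graded_hom_def by blast

lemma graded_hom_add: "v \<in> free_mod r D \<Longrightarrow> w \<in> free_mod r D \<Longrightarrow> f (v + w) = f v + f w"
  using f by (auto simp: graded_hom_def plus_fun_def)

lemma graded_hom_smult: "p \<in> polys r \<Longrightarrow> v \<in> free_mod r D \<Longrightarrow> f (p \<star> v) = p \<star> f v"
  using f by (auto simp: graded_hom_def)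

lemma graded_hom_fscal: "v \<in> free_mod r D \<Longrightarrow> f (fscal c v) = fscal c (f v)"
  unfolding fscal_eq by (rule graded_hom_smult) auto

lemma graded_hom_0: "f 0 = 0"
  using graded_hom_add[of 0 0] by simp

lemma graded_hom_minus: 
  assumes "v \<in> free_mod r D" "w \<in> free_mod r D"
  shows "f (v - w) = f v - f w"
  using graded_hom_add[of "v - w" w] assms by (simp add: algebra_simps)

lemma graded_hom_sum:
  "(\<And>i. i \<in> A \<Longrightarrow> v i \<in> free_mod r D) \<Longrightarrow> f (sum v A) = (\<Sum>i\<in>A. f (v i)) \<and> sum v A \<in> free_mod r D"
  by (induction A rule: infinite_finite_induct) (auto simp: graded_hom_add graded_hom_0)

text \<open>The component of degree \<open>e\<close> has an image of degree \<open>e\<close>, so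
  only the image of the component of degree \<open>d\<close> survives the projection to degree
  \<open>d\<close>.\<close>

lemma graded_hom_vcomp:
  assumes v: "v \<in> free_mod r D"
  shows "f (vcomp D d v) = vcomp E d (f v)"
proof -
  obtain S where S: "finite S" "d \<in> S" "v = (\<Sum>e\<in>S. vcomp D e v)"
    using sum_vcomp[OF v] by blast
  have p: "vcomp D e v \<in> free_mod_piece r D e" for e using vcomp_piece[OF v] .
  have "f v = (\<Sum>e\<in>S. f (vcomp D e v))"
    by (subst S(3)) (use graded_hom_sum[of S "\<lambda>e. vcomp D e v"] p piece_subset in blast)
  then have "vcomp E d (f v) = (\<Sum>e\<in>S. vcomp E d (f (vcomp D e v)))"
    by (simp add: vcomp_sum)
  also have "\<dots> = (\<Sum>e\<in>S. if d = e then f (vcomp D e v) else 0)"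
    using vcomp_of_piece[OF graded_hom_piece[OF p]] by (intro sum.cong) auto
  also have "\<dots> = f (vcomp D d v)" using S by simp
  finally show ?thesis by simp
qed

text \<open>Exactness is given for the whole modules; replacing a preimage of a homogeneous element
  by its component of the right degree yields exactness in every degree.\<close>

lemma graded_hom_lift_piece:
  assumes "v \<in> free_mod r D" "f v \<in> free_mod_piece r E d"
  obtains v' where "v' \<in> free_mod_piece r D d" "f v' = f v"
  using that[OF vcomp_piece[OF assms(1)]] graded_hom_vcomp[OF assms(1), of d]
    vcomp_of_piece[OF assms(2), of d] by simp

lemma graded_hom_rank_nullity:
  "fn.dim (free_mod_piece r D d :: (nat \<Rightarrow> 'k mpoly) set) =
     fn.dim {v \<in> free_mod_piece r D d. f v = 0} + fn.dim (f ` free_mod_piece r D d)"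
proof -
  interpret P: vector_space_pair "fscal :: 'k \<Rightarrow> _" "fscal :: 'k \<Rightarrow> _" by unfold_locales
  show ?thesis
  proof (rule P.rank_nullity(1))
    show "f (v + w) = f v + f w" if "v \<in> free_mod_piece r D d" "w \<in> free_mod_piece r D d" for v w
      using that piece_subset by (intro graded_hom_add) blast+
    show "f (fscal c v) = fscal c (f v)" if "v \<in> free_mod_piece r D d" for c v
      using that piece_subset by (intro graded_hom_fscal) blast
  qed simp_all
qed

end

section \<open>Resolutions of length three\<close>

lemma vsmult_piece:
  assumes "p \<in> forms r e" "v \<in> free_mod_piece r D d"
  shows "p \<star> v \<in> free_mod_piece r D (d + e)"
proof -
  have "p \<in> polys r" using assms(1) forms_subset_polys by blast
  then have "p \<star> v \<in> free_mod r D"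
    using assms(2) piece_subset by blast
  moreover have "p * v a \<in> forms r (d + e - D ! a)" if "a < length D" for a
  proof -
    have "v a \<in> forms r (d - D ! a)" using assms(2) that by (simp add: free_mod_piece_def)
    from forms_mult[OF assms(1) this] show ?thesis by (simp add: algebra_simps)
  qed
  ultimately show ?thesis by (simp add: free_mod_piece_def)
qed

lemma vsmult_add: "p \<star> (v + w) = p \<star> v + p \<star> w"
  and vsmult_minus: "p \<star> (v - w) = p \<star> v - p \<star> w"
  by (auto simp: algebra_simps)

definition fdiv :: "nat \<Rightarrow> (nat \<Rightarrow> 'k::field mpoly) \<Rightarrow> nat \<Rightarrow> 'k mpoly" where
  "fdiv k v = (\<lambda>a. divX k (v a))"

lemma fdiv_closed [simp, intro]: "v \<in> free_mod r D \<Longrightarrow> fdiv k v \<in> free_mod r D"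
  by (auto simp: free_mod_def fdiv_def)

definition frem :: "nat \<Rightarrow> (nat \<Rightarrow> 'k::field mpoly) \<Rightarrow> nat \<Rightarrow> 'k mpoly" where
  "frem k v = (\<lambda>a. remX k (v a))"

lemma frem_closed [simp, intro]: "v \<in> free_mod r D \<Longrightarrow> frem k v \<in> free_mod r D"
  by (auto simp: free_mod_def frem_def)

lemma koszul_two_fun:
  assumes "k \<noteq> l" "var k \<star> v = var l \<star> w"
  shows "w = var k \<star> fdiv l v"
proof
  fix a
  have "var k * v a = var l * w a" using fun_cong[OF assms(2), of a] by simp
  then show "w a = var k * fdiv l v a" unfolding fdiv_def by (rule koszul_two(2)[OF assms(1)])
qed

lemma koszul_three_fun:
  assumes "i \<noteq> j" "i \<noteq> k" "j \<noteq> k" "var i \<star> u + var j \<star> v + var k \<star> w = 0"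
  shows "u = - (var j \<star> fdiv i v) - var k \<star> fdiv i w"
proof
  fix a
  have "var i * u a + var j * v a + var k * w a = 0" using fun_cong[OF assms(4), of a] by simp
  from koszul_three[OF assms(1-3) this]
  show "u a = (- (var j \<star> fdiv i v) - var k \<star> fdiv i w) a" by (simp add: fdiv_def)
qed

locale resolution3 =
  fixes I :: "'k::field mpoly set" and D :: "nat \<Rightarrow> int list"
    and \<phi> :: "nat \<Rightarrow> (nat \<Rightarrow> 'k mpoly) \<Rightarrow> nat \<Rightarrow> 'k mpoly"
  assumes res: "minimal_graded_free_resolution 3 I D \<phi>"
begin

lemma hom1: "graded_hom 3 (D 1) [0] (\<phi> 1)"
  and hom2: "graded_hom 3 (D 2) (D 1) (\<phi> 2)"
  and hom3: "graded_hom 3 (D 3) (D 2) (\<phi> 3)"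
proof -
  have *: "D 0 = [0]" "\<And>i. 1 \<le> i \<Longrightarrow> graded_hom 3 (D i) (D (i - 1)) (\<phi> i)"
    using res unfolding minimal_graded_free_resolution_def by blast+
  show "graded_hom 3 (D 1) [0] (\<phi> 1)" using *(1) *(2)[of 1] by simp
  show "graded_hom 3 (D 2) (D 1) (\<phi> 2)" using *(2)[of 2] by simp
  show "graded_hom 3 (D 3) (D 2) (\<phi> 3)" using *(2)[of 3] by simp
qed

lemma hom: "1 \<le> i \<Longrightarrow> graded_hom 3 (D i) (D (i - 1)) (\<phi> i)"
  using res unfolding minimal_graded_free_resolution_def by blast

lemma exact: "1 \<le> i \<Longrightarrow> \<phi> (Suc i) ` free_mod 3 (D (Suc i)) = {v \<in> free_mod 3 (D i). \<phi> i v = 0}"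
  using res unfolding minimal_graded_free_resolution_def zero_fun_def by blast

lemma exact1: "\<phi> 2 ` free_mod 3 (D 2) = {v \<in> free_mod 3 (D 1). \<phi> 1 v = 0}"
  and exact2: "\<phi> 3 ` free_mod 3 (D 3) = {v \<in> free_mod 3 (D 2). \<phi> 2 v = 0}"
  using exact[of 1] exact[of 2] by (simp_all add: numeral_2_eq_2 numeral_3_eq_3)

lemma exact3: "{v \<in> free_mod 3 (D 3). \<phi> 3 v = 0} \<subseteq> {0}"
proof -
  have D4: "D 4 = []"
    using res unfolding minimal_graded_free_resolution_def by auto
  have "free_mod 3 (D 4) = {0}" unfolding D4 by (auto simp: free_mod_def)
  then have "\<phi> 4 ` free_mod 3 (D 4) = {0}"
    using graded_hom_0[OF hom[of 4]] by (metis One_nat_def image_insert image_empty Suc_leI zero_less_numeral)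
  then show ?thesis using exact[of 3] by simp
qed

lemma image1: "(\<lambda>v. v 0) ` \<phi> 1 ` free_mod 3 (D 1) = I"
  using res unfolding minimal_graded_free_resolution_def by blast

lemma minimal: "1 \<le> i \<Longrightarrow> v \<in> free_mod 3 (D i) \<Longrightarrow> lkp (\<phi> i v a) 0 = 0"
  using res unfolding minimal_graded_free_resolution_def irrelevant_ideal_def by blast

lemma phi1_eqI:
  assumes "v \<in> free_mod 3 (D 1)" "\<phi> 1 v 0 = f"
  shows "\<phi> 1 v = unitv 0 f"
  using graded_hom_closed[OF hom1 assms(1)] assms(2)
  by (auto simp: free_mod_def unitv_def)

text \<open>Rank-nullity in degree \<open>d\<close> for the three maps: each kernel is the image of
  the next map and \<open>\<phi> 3\<close> is injective, so the kernel dimensions cancel in the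
  alternating sum.\<close>

lemma dim_ideal_piece:
  "int (mp.dim (I \<inter> forms 3 d)) = int (\<Sum>j\<leftarrow>D 1. num_forms 3 (d - j))
     - int (\<Sum>j\<leftarrow>D 2. num_forms 3 (d - j)) + int (\<Sum>j\<leftarrow>D 3. num_forms 3 (d - j))"
proof -
  let ?P = "\<lambda>i. free_mod_piece 3 (D i) d :: (nat \<Rightarrow> 'k mpoly) set"
  let ?K = "\<lambda>i. {v \<in> ?P i. \<phi> i v = 0}"
  have K3: "?K 3 = {0}"
    using exact3 piece_subset graded_hom_0[OF hom3] fn.subspace_0[OF subspace_piece] by blast
  have K2: "\<phi> 3 ` ?P 3 = ?K 2"
  proof
    show "\<phi> 3 ` ?P 3 \<subseteq> ?K 2"
      using graded_hom_piece[OF hom3] exact2 piece_subset by blast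
    show "?K 2 \<subseteq> \<phi> 3 ` ?P 3"
    proof
      fix v assume v: "v \<in> ?K 2"
      then have "v \<in> \<phi> 3 ` free_mod 3 (D 3)" using exact2 piece_subset by blast
      then obtain u where u: "u \<in> free_mod 3 (D 3)" "v = \<phi> 3 u" by blast
      then obtain u' where u': "u' \<in> ?P 3" "\<phi> 3 u' = \<phi> 3 u"
        using graded_hom_lift_piece[OF hom3 u(1)] v by blast
      show "v \<in> \<phi> 3 ` ?P 3" by (rule image_eqI[of _ _ u']) (simp_all add: u' u)
    qed
  qed
  have K1: "\<phi> 2 ` ?P 2 = ?K 1"
  proof
    show "\<phi> 2 ` ?P 2 \<subseteq> ?K 1"
      using graded_hom_piece[OF hom2] exact1 piece_subset by blast
    show "?K 1 \<subseteq> \<phi> 2 ` ?P 2"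
    proof
      fix v assume v: "v \<in> ?K 1"
      then have "v \<in> \<phi> 2 ` free_mod 3 (D 2)" using exact1 piece_subset by blast
      then obtain u where u: "u \<in> free_mod 3 (D 2)" "v = \<phi> 2 u" by blast
      then obtain u' where u': "u' \<in> ?P 2" "\<phi> 2 u' = \<phi> 2 u"
        using graded_hom_lift_piece[OF hom2 u(1)] v by blast
      show "v \<in> \<phi> 2 ` ?P 2" by (rule image_eqI[of _ _ u']) (simp_all add: u' u)
    qed
  qed
  have I1: "\<phi> 1 ` ?P 1 = unitv 0 ` (I \<inter> forms 3 d)"
  proof
    show "\<phi> 1 ` ?P 1 \<subseteq> unitv 0 ` (I \<inter> forms 3 d)"
    proof
      fix w assume "w \<in> \<phi> 1 ` ?P 1"
      then obtain v where v: "v \<in> ?P 1" "w = \<phi> 1 v" by blast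
      have vf: "v \<in> free_mod 3 (D 1)" using v(1) piece_subset by blast
      have "\<phi> 1 v 0 \<in> forms 3 (d - [0] ! 0)"
        using graded_hom_piece[OF hom1 v(1)] by (simp add: free_mod_piece_def)
      moreover have "\<phi> 1 v 0 \<in> I" using image1 vf by blast
      ultimately show "w \<in> unitv 0 ` (I \<inter> forms 3 d)"
        using phi1_eqI[OF vf refl] v(2) by auto
    qed
    show "unitv 0 ` (I \<inter> forms 3 d) \<subseteq> \<phi> 1 ` ?P 1"
    proof
      fix w assume "w \<in> unitv 0 ` (I \<inter> forms 3 d)"
      then obtain f where f: "f \<in> I" "f \<in> forms 3 d" "w = unitv 0 f" by blast
      then obtain v where v: "v \<in> free_mod 3 (D 1)" "\<phi> 1 v 0 = f" using image1 by blast
      have w: "\<phi> 1 v = w" using phi1_eqI[OF v] f by simp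
      have "w \<in> free_mod_piece 3 [0] d" unfolding f(3) using f(2) by (intro unitv_piece) auto
      then obtain v' where v': "v' \<in> ?P 1" "\<phi> 1 v' = \<phi> 1 v"
        using graded_hom_lift_piece[OF hom1 v(1)] w by blast
      show "w \<in> \<phi> 1 ` ?P 1" by (rule image_eqI[of _ _ v']) (use v' w in simp_all)
    qed
  qed
  \<comment> \<open>The image of \<open>\<phi> 1\<close> consists of vectors with a single
    coordinate; reading it off identifies the image with the ideal piece, although the two lie in
    different vector spaces.\<close>
  have dI: "fn.dim (\<phi> 1 ` ?P 1) = mp.dim (I \<inter> forms 3 d)"
  proof -
    interpret P: vector_space_pair "fscal :: 'k \<Rightarrow> _" "scal :: 'k \<Rightarrow> _" by unfold_locales
    interpret Q: vector_space_pair "fscal :: 'k \<Rightarrow> _" "fscal :: 'k \<Rightarrow> _" by unfold_locales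
    let ?V = "\<phi> 1 ` ?P 1"
    have add: "\<phi> 1 (v + w) = \<phi> 1 v + \<phi> 1 w" if "v \<in> ?P 1" "w \<in> ?P 1" for v w
      using that piece_subset by (intro graded_hom_add[OF hom1]) blast+
    have scl: "\<phi> 1 (fscal c v) = fscal c (\<phi> 1 v)" if "v \<in> ?P 1" for v c
      using that piece_subset by (intro graded_hom_fscal[OF hom1]) blast
    note V = Q.rank_nullity(2,3)[OF subspace_piece finspan_piece add scl]
    have "fn.dim ?V = fn.dim {v \<in> ?V. v 0 = 0} + mp.dim ((\<lambda>v. v 0) ` ?V)"
      by (rule P.rank_nullity(1)[OF V]) (simp_all add: fscal_def)
    moreover have "{v \<in> ?V. v 0 = 0} = {0}"
    proof
      show "{v \<in> ?V. v 0 = 0} \<subseteq> {0}" unfolding I1 by (auto simp: unitv_def)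
      show "{0} \<subseteq> {v \<in> ?V. v 0 = 0}" using fn.subspace_0[OF V(1)] by simp
    qed
    moreover have "(\<lambda>v. v 0) ` ?V = I \<inter> forms 3 d"
      unfolding I1 by (simp add: image_image unitv_def)
    ultimately show ?thesis by simp
  qed
  note rn = graded_hom_rank_nullity[OF hom1, of d] graded_hom_rank_nullity[OF hom2, of d]
    graded_hom_rank_nullity[OF hom3, of d]
  show ?thesis
    using rn unfolding K1 K2 K3 dI dim_piece by simp
qed

text \<open>By exactness a basis vector in the kernel would be an image under the next map, but
  minimality forbids constant terms in the coordinates of such an image.\<close>

lemma phi_unit_nonzero:
  assumes "1 \<le> i" "a < length (D i)"
  shows "unitv a 1 \<in> free_mod_piece 3 (D i) (D i ! a)" "\<phi> i (unitv a 1) \<noteq> 0"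
proof -
  show p: "unitv a 1 \<in> free_mod_piece 3 (D i) (D i ! a)"
    using assms by (intro unitv_piece) auto
  show "\<phi> i (unitv a 1) \<noteq> 0"
  proof
    assume "\<phi> i (unitv a 1) = 0"
    then have "unitv a 1 \<in> \<phi> (Suc i) ` free_mod 3 (D (Suc i))"
      using exact[OF assms(1)] p piece_subset by blast
    then obtain v where v: "v \<in> free_mod 3 (D (Suc i))" "unitv a 1 = \<phi> (Suc i) v" by blast
    have "lkp (unitv a 1 a :: 'k mpoly) 0 = 0"
      unfolding v(2) using minimal[OF _ v(1)] assms by simp
    then show False by (simp add: unitv_def)
  qed
qed

text \<open>Some coordinate of the image of a basis vector is nonzero. It is a form of degree
  \<open>j - D i ! c\<close> without constant term, so this degree is positive.\<close>

lemma shifts_increase: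
  assumes "1 \<le> i" "j \<in> set (D (Suc i))"
  shows "\<exists>j'\<in>set (D i). j' < j"
proof -
  obtain a where a: "a < length (D (Suc i))" "j = D (Suc i) ! a"
    using assms(2) by (auto simp: in_set_conv_nth)
  let ?w = "\<phi> (Suc i) (unitv a 1)"
  have e: "unitv a 1 \<in> free_mod_piece 3 (D (Suc i)) j" "?w \<noteq> 0"
    using phi_unit_nonzero[of "Suc i" a] a by auto
  have w: "?w \<in> free_mod_piece 3 (D i) j"
    using graded_hom_piece[OF hom[of "Suc i"] e(1)] by simp
  obtain c where c: "?w c \<noteq> 0" using e(2) by (auto simp: fun_eq_iff)
  have "\<forall>c\<ge>length (D i). ?w c = 0"
    using w by (simp add: free_mod_piece_def free_mod_def)
  then have cl: "c < length (D i)" using c by (meson not_less)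
  have f: "?w c \<in> forms 3 (j - D i ! c)" using w cl by (simp add: free_mod_piece_def)
  have z: "lkp (?w c) 0 = 0"
    by (rule minimal[OF _ subsetD[OF piece_subset e(1)]]) simp
  have "\<not> j - D i ! c < 0" using f c forms_neg by blast
  moreover have "j - D i ! c \<noteq> 0"
    using f c z forms_0_scalar[of "?w c" 3] by auto
  ultimately show ?thesis using cl by (intro bexI[of _ "D i ! c"]) auto
qed

text \<open>A basis vector of degree \<open>j\<close> is mapped to a nonzero form of degree
  \<open>j\<close> in \<open>I\<close>.\<close>

lemma shifts1_lower:
  assumes "\<And>j. j < b \<Longrightarrow> I \<inter> forms 3 j \<subseteq> {0}" "j \<in> set (D 1)"
  shows "b \<le> j"
proof (rule ccontr)
  assume "\<not> b \<le> j"
  obtain a where a: "a < length (D 1)" "j = D 1 ! a"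
    using assms(2) by (auto simp: in_set_conv_nth)
  let ?w = "\<phi> 1 (unitv a 1)"
  have e: "unitv a 1 \<in> free_mod_piece 3 (D 1) j" "?w \<noteq> 0"
    using phi_unit_nonzero[of 1 a] a by auto
  have ef: "unitv a 1 \<in> free_mod 3 (D 1)" using e(1) piece_subset by blast
  have "?w 0 \<in> forms 3 j"
    using graded_hom_piece[OF hom1 e(1)] by (simp add: free_mod_piece_def)
  moreover have "?w 0 \<in> I" using image1 ef by blast
  ultimately have "?w 0 = 0" using assms(1)[of j] \<open>\<not> b \<le> j\<close> by auto
  then have "?w = 0" using phi1_eqI[OF ef] by (auto simp: unitv_def)
  then show False using e(2) by simp
qed

text \<open>The Koszul complex on the three variables is compared with the resolution: a socle element
  in degree \<open>i\<close> lifts to an element of \<open>F\<^sub>3\<close> of degree \<open>i + 3\<close>, and if that element lies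
  in \<open>\<mm>F\<^sub>3\<close>, then the lift can be corrected to zero.\<close>

lemma socle_shift:
  assumes f: "f \<in> forms 3 i" "f \<notin> I" and soc: "\<And>k. k < 3 \<Longrightarrow> var k * f \<in> I"
  shows "i + 3 \<in> set (D 3)"
proof (rule ccontr)
  assume no: "i + 3 \<notin> set (D 3)"
  let ?F = "unitv 0 f :: nat \<Rightarrow> 'k mpoly"
  have v3: "var k \<in> polys 3" "var k \<in> forms 3 1" if "k < 3" for k :: nat
    using that by auto
  have "\<exists>g. g \<in> free_mod_piece 3 (D 1) (i + 1) \<and> \<phi> 1 g = var k \<star> ?F" if k: "k < 3" for k
  proof -
    obtain v where v: "v \<in> free_mod 3 (D 1)" "\<phi> 1 v 0 = var k * f"
      using soc[OF k] image1 by force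
    have w: "\<phi> 1 v = var k \<star> ?F"
      using phi1_eqI[OF v] by (auto simp: unitv_def)
    have "?F \<in> free_mod_piece 3 [0] i" using f by (intro unitv_piece) auto
    then have "\<phi> 1 v \<in> free_mod_piece 3 [0] (i + 1)"
      unfolding w using vsmult_piece v3[OF k] by blast
    then show ?thesis using graded_hom_lift_piece[OF hom1 v(1)] w by metis
  qed
  then obtain g where g: "\<And>k. k < 3 \<Longrightarrow> g k \<in> free_mod_piece 3 (D 1) (i + 1)"
    "\<And>k. k < 3 \<Longrightarrow> \<phi> 1 (g k) = var k \<star> ?F" by metis
  have gf: "g k \<in> free_mod 3 (D 1)" if "k < 3" for k using g(1)[OF that] piece_subset by blast
  \<comment> \<open>Second stage of the comparison: \<open>g\<close> lifts the products of
    \<open>f\<close> with the variables, and the Koszul relation of two variables makes these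
    differences cycles, to be lifted by \<open>h k l\<close>.\<close>
  have "\<exists>h. h \<in> free_mod_piece 3 (D 2) (i + 2) \<and> \<phi> 2 h = var k \<star> g l - var l \<star> g k"
    if k: "k < 3" and l: "l < 3" for k l
  proof -
    let ?z = "var k \<star> g l - var l \<star> g k"
    have "var k \<star> g l \<in> free_mod_piece 3 (D 1) (i + 1 + 1)" "var l \<star> g k \<in> free_mod_piece 3 (D 1) (i + 1 + 1)"
      by (rule vsmult_piece[OF v3(2) g(1)]; use k l in simp)+
    then have z: "?z \<in> free_mod_piece 3 (D 1) (i + 2)"
      using fn.subspace_diff[OF subspace_piece] by (simp add: add.assoc)
    have "\<phi> 1 ?z = \<phi> 1 (var k \<star> g l) - \<phi> 1 (var l \<star> g k)"
      using v3 gf k l by (intro graded_hom_minus[OF hom1]) auto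
    also have "\<dots> = var k \<star> \<phi> 1 (g l) - var l \<star> \<phi> 1 (g k)"
      using graded_hom_smult[OF hom1 v3(1) gf] k l by simp
    also have "\<dots> = 0" using g(2) k l by (auto simp: mult.left_commute)
    finally have "?z \<in> \<phi> 2 ` free_mod 3 (D 2)" using exact1 z piece_subset by blast
    then obtain u where u: "u \<in> free_mod 3 (D 2)" "?z = \<phi> 2 u" by blast
    then show ?thesis using graded_hom_lift_piece[OF hom2 u(1)] z by metis
  qed
  then obtain h where h: "\<And>k l. k < 3 \<Longrightarrow> l < 3 \<Longrightarrow> h k l \<in> free_mod_piece 3 (D 2) (i + 2)"
    "\<And>k l. k < 3 \<Longrightarrow> l < 3 \<Longrightarrow> \<phi> 2 (h k l) = var k \<star> g l - var l \<star> g k" by metis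
  have hf: "h k l \<in> free_mod 3 (D 2)" if "k < 3" "l < 3" for k l
    using h(1)[OF that] piece_subset by blast
  \<comment> \<open>The signs are those of the last Koszul differential; they make \<open>?y\<close>
    a cycle.\<close>
  let ?y = "var 0 \<star> h 1 2 - var 1 \<star> h 0 2 + var 2 \<star> h 0 1"
  have y: "?y \<in> free_mod_piece 3 (D 2) (i + 3)"
  proof -
    have "var k \<star> h l n \<in> free_mod_piece 3 (D 2) (i + 3)" if "k < 3" "l < 3" "n < 3" for k l n
      using vsmult_piece[OF v3(2)[OF that(1)] h(1)[OF that(2,3)]] by (simp add: add.assoc)
    then show ?thesis
      by (intro fn.subspace_add[OF subspace_piece] fn.subspace_diff[OF subspace_piece]) auto
  qed
  have "\<phi> 2 ?y = var 0 \<star> \<phi> 2 (h 1 2) - var 1 \<star> \<phi> 2 (h 0 2) + var 2 \<star> \<phi> 2 (h 0 1)"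
    using graded_hom_add[OF hom2] graded_hom_minus[OF hom2] graded_hom_smult[OF hom2] hf v3(1)
    by simp
  also have "\<dots> = 0"
  proof -
    have e: "\<phi> 2 (h 1 2) = var 1 \<star> g 2 - var 2 \<star> g 1" "\<phi> 2 (h 0 2) = var 0 \<star> g 2 - var 2 \<star> g 0"
      "\<phi> 2 (h 0 1) = var 0 \<star> g 1 - var 1 \<star> g 0"
      by (rule h(2); simp)+
    show ?thesis unfolding e by (rule ext) (simp add: algebra_simps)
  qed
  finally have "?y \<in> \<phi> 3 ` free_mod 3 (D 3)" using exact2 y piece_subset by blast
  then obtain u where u: "u \<in> free_mod 3 (D 3)" "?y = \<phi> 3 u" by blast
  then obtain w where w: "w \<in> free_mod_piece 3 (D 3) (i + 3)" "\<phi> 3 w = ?y"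
    using graded_hom_lift_piece[OF hom3 u(1)] y by metis
  have wf: "w \<in> free_mod 3 (D 3)" using w(1) piece_subset by blast
  \<comment> \<open>As \<open>i + 3\<close> is not a shift, no coordinate of \<open>w\<close> has
    degree 0, so \<open>w\<close> is a combination of the three variables with coefficients in the
    third module.\<close>
  define w0 w1 w2 where "w0 = fdiv 0 w" and "w1 = fdiv 1 (frem 0 w)" and "w2 = fdiv 2 (frem 1 (frem 0 w))"
  have wcl: "w0 \<in> free_mod 3 (D 3)" "w1 \<in> free_mod 3 (D 3)" "w2 \<in> free_mod 3 (D 3)"
    unfolding w0_def w1_def w2_def using wf by auto
  have wdec: "w = var 0 \<star> w0 + var 1 \<star> w1 + var 2 \<star> w2"
  proof
    fix a
    have "w a \<in> polys 3 \<and> lkp (w a) 0 = 0"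
    proof (cases "a < length (D 3)")
      case True
      then have "w a \<in> forms 3 (i + 3 - D 3 ! a)" using w(1) by (simp add: free_mod_piece_def)
      moreover have "i + 3 - D 3 ! a \<noteq> 0" using no True by (metis eq_iff_diff_eq_0 nth_mem)
      ultimately show ?thesis using lookup_0_forms forms_subset_polys by blast
    next
      case False
      then show ?thesis using wf by (auto simp: free_mod_def)
    qed
    then show "w a = (var 0 \<star> w0 + var 1 \<star> w1 + var 2 \<star> w2) a"
      unfolding w0_def w1_def w2_def fdiv_def frem_def
      using irrelevant_decomp[of "w a"] by simp
  qed
  have "\<phi> 3 w = var 0 \<star> \<phi> 3 w0 + var 1 \<star> \<phi> 3 w1 + var 2 \<star> \<phi> 3 w2"
    unfolding wdec
    using graded_hom_add[OF hom3] graded_hom_smult[OF hom3] wcl v3(1) by simp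
  \<comment> \<open>The lifts \<open>h\<close> are corrected by images under
    \<open>\<phi> 3\<close>, which \<open>\<phi> 2\<close> does not see. After the correction their
    Koszul combination is 0 itself instead of a boundary.\<close>
  define p q s where "p = h 1 2 - \<phi> 3 w0" and "q = - (h 0 2 + \<phi> 3 w1)" and "s = h 0 1 - \<phi> 3 w2"
  have phi3: "\<phi> 3 v \<in> free_mod 3 (D 2)" "\<phi> 2 (\<phi> 3 v) = 0" if "v \<in> free_mod 3 (D 3)" for v
    using exact2 that by blast+
  have cl: "p \<in> free_mod 3 (D 2)" "q \<in> free_mod 3 (D 2)" "s \<in> free_mod 3 (D 2)"
    unfolding p_def q_def s_def using hf phi3(1) wcl by auto
  have "var 0 \<star> p + var 1 \<star> q + var 2 \<star> s = ?y - \<phi> 3 w"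
    unfolding \<open>\<phi> 3 w = var 0 \<star> _ + _ + _\<close> p_def q_def s_def by (auto simp: algebra_simps)
  then have "var 0 \<star> p + var 1 \<star> q + var 2 \<star> s = 0" using w(2) by simp
  then have p: "p = - (var 1 \<star> fdiv 0 q) - var 2 \<star> fdiv 0 s"
    by (intro koszul_three_fun) auto
  \<comment> \<open>The Koszul syzygy expresses \<open>p\<close> through these two vectors, and
    their images under \<open>\<phi> 2\<close> correct \<open>g 2\<close> and \<open>g 1\<close> one
    level further down.\<close>
  define d2 d3 where "d2 = fdiv 0 q" and "d3 = fdiv 0 s"
  have dcl: "d2 \<in> free_mod 3 (D 2)" "d3 \<in> free_mod 3 (D 2)"
    unfolding d2_def d3_def using cl by auto
  have "\<phi> 2 p + (var 1 \<star> \<phi> 2 d2 + var 2 \<star> \<phi> 2 d3) = \<phi> 2 (p + (var 1 \<star> d2 + var 2 \<star> d3))"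
    using graded_hom_add[OF hom2] graded_hom_smult[OF hom2] cl dcl v3(1) by simp
  also have "\<dots> = 0"
  proof -
    have "p + (var 1 \<star> d2 + var 2 \<star> d3) = 0"
      unfolding d2_def d3_def by (subst p) simp
    then show ?thesis using graded_hom_0[OF hom2] by (simp only:)
  qed
  finally have "\<phi> 2 p + (var 1 \<star> \<phi> 2 d2 + var 2 \<star> \<phi> 2 d3) = 0" .
  moreover have "\<phi> 2 p = var 1 \<star> g 2 - var 2 \<star> g 1"
    unfolding p_def using graded_hom_minus[OF hom2] hf phi3 wcl h(2)[of 1 2] by simp
  ultimately have "var 1 \<star> (g 2 + \<phi> 2 d2) - var 2 \<star> (g 1 - \<phi> 2 d3) = 0"
    unfolding vsmult_add vsmult_minus by (simp only: algebra_simps)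
  then have eq: "var 1 \<star> (g 2 + \<phi> 2 d2) = var 2 \<star> (g 1 - \<phi> 2 d3)"
    by (simp only: right_minus_eq)
  define t where "t = fdiv 2 (g 2 + \<phi> 2 d2)"
  have phi2: "\<phi> 2 v \<in> free_mod 3 (D 1)" "\<phi> 1 (\<phi> 2 v) = 0" if "v \<in> free_mod 3 (D 2)" for v
    using exact1 that by blast+
  have tf: "t \<in> free_mod 3 (D 1)"
    unfolding t_def using gf phi2 dcl by auto
  have t: "g 1 - \<phi> 2 d3 = var 1 \<star> t"
    unfolding t_def by (rule koszul_two_fun[OF _ eq]) simp
  \<comment> \<open>The corrected \<open>g 1\<close> is divisible by the variable 1. Cancelling this
    variable exhibits \<open>f\<close> as an image under \<open>\<phi> 1\<close>, that is, as an
    element of \<open>I\<close>.\<close>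
  have "var 1 \<star> ?F = \<phi> 1 (g 1)" using g(2)[of 1] by simp
  also have "\<dots> = \<phi> 1 (g 1 - \<phi> 2 d3)"
    using graded_hom_minus[OF hom1 gf phi2(1)] phi2 dcl by simp
  also have "\<dots> = var 1 \<star> \<phi> 1 t"
    unfolding t by (rule graded_hom_smult[OF hom1 _ tf]) auto
  finally have "var 1 * f = var 1 * \<phi> 1 t 0" by (metis unitv_def)
  then have "f = \<phi> 1 t 0" by (rule var_mult_cancel)
  then show False using f(2) image1 tf by blast
qed

end

section \<open>Graded quotients\<close>

context vector_space
begin

text \<open>A basis of \<open>I\<close> is sent to 0 and the vectors completing it to a basis of the
  whole space are fixed. The quotient by \<open>I\<close> is thus modelled inside the space
  itself.\<close>

lemma linear_projection_along:
  assumes "subspace I"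
  obtains f where "Vector_Spaces.linear scale scale f" "\<And>x. f x = 0 \<longleftrightarrow> x \<in> I" "\<And>x. x - f x \<in> I"
proof -
  interpret P: vector_space_pair scale scale by unfold_locales
  obtain B where B: "B \<subseteq> I" "independent B" "I \<subseteq> span B"
    by (rule maximal_independent_subset)
  have spanB: "span B = I" using B span_minimal[OF B(1) assms] by blast
  obtain C where C: "B \<subseteq> C" "independent C" "UNIV \<subseteq> span C"
    by (rule maximal_independent_subset_extend[OF subset_UNIV B(2)])
  define f where "f = P.construct C (\<lambda>b. if b \<in> B then 0 else b)"
  have lin: "Vector_Spaces.linear scale scale f"
    unfolding f_def by (rule P.linear_construct[OF C(2)])
  have fC: "f b = (if b \<in> B then 0 else b)" if "b \<in> C" for b
    unfolding f_def by (rule P.construct_basis[OF C(2) that])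
  have diff: "x - f x \<in> I" for x
  proof -
    have "x \<in> span C" using C(3) by blast
    then show ?thesis
    proof (induction rule: span_induct_alt)
      case base
      then show ?case using P.linear_0[OF lin] subspace_0[OF assms] by simp
    next
      case (step c b y)
      have b: "b - f b \<in> I" using fC[OF step(1)] B(1) subspace_0[OF assms] by auto
      have eq: "scale c b + y - f (scale c b + y) = scale c (b - f b) + (y - f y)"
        by (simp add: P.linear_add[OF lin] P.linear_scale[OF lin] scale_right_diff_distrib algebra_simps)
      show ?case
        unfolding eq by (rule subspace_add[OF assms subspace_scale[OF assms b] step(2)])
    qed
  qed
  have zero: "f x = 0" if "x \<in> I" for x
  proof -
    have "x \<in> span B" using that spanB by simp
    then show ?thesis
    proof (induction rule: span_induct_alt)
      case base
      then show ?case using P.linear_0[OF lin] by simp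
    next
      case (step c b y)
      have "f b = 0" using fC[of b] step(1) C(1) by auto
      then show ?case using step by (simp add: P.linear_add[OF lin] P.linear_scale[OF lin])
    qed
  qed
  have mem: "x \<in> I" if "f x = 0" for x using diff[of x] that by simp
  show ?thesis
  proof (rule that[OF lin])
    show "f x = 0 \<longleftrightarrow> x \<in> I" for x using zero mem by (rule iffI[rotated])
    show "x - f x \<in> I" for x by (rule diff)
  qed
qed

end

section \<open>The polynomial ring as a ring structure, and its field of constants\<close>

lemma mpoly_ring_simps [simp]:
  "mult (mpoly_ring r) = (*)" "one (mpoly_ring r) = 1" "zero (mpoly_ring r) = 0" "add (mpoly_ring r) = (+)"
  by (simp_all add: mpoly_ring_def)

lemma cring_mpoly_ring: "cring (mpoly_ring r :: 'k::field mpoly ring)"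
proof (rule cringI)
  show "abelian_group (mpoly_ring r :: 'k mpoly ring)"
    by (rule abelian_groupI) (auto simp: add.assoc add.commute intro!: bexI[of _ "- _"])
  show "comm_monoid (mpoly_ring r :: 'k mpoly ring)"
    by unfold_locales (auto simp: mult.assoc mult.commute)
qed (auto simp: distrib_right)

lemma a_inv_mpoly_ring: "p \<in> polys r \<Longrightarrow> a_inv (mpoly_ring r) p = - p"
proof -
  assume "p \<in> polys r"
  interpret cring "mpoly_ring r" by (rule cring_mpoly_ring)
  show ?thesis
    by (rule minus_equality) (use \<open>p \<in> polys r\<close> in auto)
qed

text \<open>The image of this subfield in the quotient is \<open>base_field\<close>; that it is a
  subfield makes the dimension over it unique.\<close>

lemma subfield_constants:
  "subfield (range (Poly_Mapping.single 0)) (mpoly_ring r :: 'k::field mpoly ring)"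
proof -
  interpret R: cring "mpoly_ring r :: 'k mpoly ring" by (rule cring_mpoly_ring)
  let ?K = "range (Poly_Mapping.single 0) :: 'k mpoly set"
  have sub: "subring ?K (mpoly_ring r)"
  proof (rule R.subringI)
    show "\<one>\<^bsub>mpoly_ring r\<^esub> \<in> ?K" by (auto intro!: image_eqI[of _ _ 1])
    show "\<ominus>\<^bsub>mpoly_ring r\<^esub> h \<in> ?K" if "h \<in> ?K" for h
      using that by (auto simp: a_inv_mpoly_ring single_uminus[symmetric])
    show "h1 \<otimes>\<^bsub>mpoly_ring r\<^esub> h2 \<in> ?K" if "h1 \<in> ?K" "h2 \<in> ?K" for h1 h2
      using that by (auto simp: mult_single)
    show "h1 \<oplus>\<^bsub>mpoly_ring r\<^esub> h2 \<in> ?K" if "h1 \<in> ?K" "h2 \<in> ?K" for h1 h2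
      using that by (auto simp: single_add[symmetric])
  qed auto
  show ?thesis
  proof (rule R.subfieldI)
    show "subcring ?K (mpoly_ring r)" by (rule R.subcringI'[OF sub])
    show "Units (mpoly_ring r \<lparr>carrier := ?K\<rparr>) = ?K - {\<zero>\<^bsub>mpoly_ring r\<^esub>}"
    proof
      show "Units (mpoly_ring r \<lparr>carrier := ?K\<rparr>) \<subseteq> ?K - {\<zero>\<^bsub>mpoly_ring r\<^esub>}"
        by (auto simp: Units_def)
      show "?K - {\<zero>\<^bsub>mpoly_ring r\<^esub>} \<subseteq> Units (mpoly_ring r \<lparr>carrier := ?K\<rparr>)"
      proof
        fix x assume "x \<in> ?K - {\<zero>\<^bsub>mpoly_ring r\<^esub>}"
        then obtain c where c: "x = Poly_Mapping.single 0 c" by blast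
        have "x \<noteq> 0" using \<open>x \<in> ?K - _\<close> by simp
        then have "c \<noteq> 0" by (cases "c = 0") (simp_all add: c)
        then have "Poly_Mapping.single 0 (inverse c) * x = 1" "x * Poly_Mapping.single 0 (inverse c) = 1"
          unfolding c by (simp_all add: mult_single)
        then have "\<exists>y\<in>?K. y * x = 1 \<and> x * y = 1"
          by (intro bexI[of _ "Poly_Mapping.single 0 (inverse c)"] conjI) (assumption, assumption, rule rangeI)
        moreover have "x \<in> ?K" unfolding c by (rule rangeI)
        ultimately show "x \<in> Units (mpoly_ring r \<lparr>carrier := ?K\<rparr>)"
          unfolding Units_def by (simp del: image_iff rangeE)
      qed
    qed
  qed
qed

locale std_algebra =
  fixes r :: nat and I :: "'k::field mpoly set"
  assumes alg: "std_artinian_algebra r I"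
begin

lemma ideal: "ideal I (mpoly_ring r)"
  and homogeneous: "p \<in> I \<Longrightarrow> hcomp d p \<in> I"
  and proper: "I \<noteq> polys r"
  and artinian: "artinian_ring (quot_alg r I)"
proof -
  have h: "homogeneous_ideal r I" "I \<noteq> polys r" "artinian_ring (quot_alg r I)"
    using alg unfolding std_artinian_algebra_def by auto
  then show i: "ideal I (mpoly_ring r)" unfolding homogeneous_ideal_def by simp
  show "I \<noteq> polys r" "artinian_ring (quot_alg r I)" using h by auto
  show "hcomp d p \<in> I" if "p \<in> I" for d p
  proof (cases "d < 0")
    case True
    interpret ideal I "mpoly_ring r" by fact
    show ?thesis using hcomp_neg[OF True, of p] additive_subgroup.zero_closed[OF additive_subgroup_axioms] by simp
  next
    case False
    then have "hcomp d p = hom_component (nat d) p" by (simp add: hom_component_eq_hcomp)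
    then show ?thesis using h(1) that unfolding homogeneous_ideal_def by simp
  qed
qed

interpretation J: ideal I "mpoly_ring r" by (rule ideal)
interpretation Q: ring "quot_alg r I" unfolding quot_alg_def by (rule J.quotient_is_ring)

abbreviation rc where "rc \<equiv> residue_class r I"

lemma ideal_polys: "I \<subseteq> polys r"
  using J.a_subset .

lemma ideal_mult: "p \<in> polys r \<Longrightarrow> q \<in> I \<Longrightarrow> p * q \<in> I"
  using J.I_l_closed[of q p] by simp

lemma subspace_ideal: "mp.subspace I"
proof (rule mp.subspaceI)
  show "0 \<in> I" using additive_subgroup.zero_closed[OF J.additive_subgroup_axioms] by simp
  show "p + q \<in> I" if "p \<in> I" "q \<in> I" for p q using additive_subgroup.a_closed[OF J.additive_subgroup_axioms that] by simp
  show "scal c p \<in> I" if "p \<in> I" for c p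
    unfolding scal_def using that by (intro ideal_mult) auto
qed

lemma one_not_in_ideal: "1 \<notin> I"
  using proper ideal_polys ideal_mult[of _ 1] by auto

lemma rc_eq_iff:
  assumes "p \<in> polys r" "q \<in> polys r"
  shows "rc p = rc q \<longleftrightarrow> p - q \<in> I"
proof -
  have rc: "rc s = (\<lambda>i. i + s) ` I" for s
    by (auto simp: residue_class_def a_r_coset_def')
  show ?thesis
  proof
    assume "rc p = rc q"
    moreover have "0 + p \<in> rc p" unfolding rc using mp.subspace_0[OF subspace_ideal] by blast
    ultimately obtain i where "i \<in> I" "0 + p = i + q" unfolding rc by blast
    then show "p - q \<in> I" by (simp add: algebra_simps)
  next
    assume d: "p - q \<in> I"
    have "i + p = (i + (p - q)) + q" "i + q = (i - (p - q)) + p" for i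
      by (simp_all add: algebra_simps)
    then show "rc p = rc q"
      unfolding rc using mp.subspace_add[OF subspace_ideal _ d] mp.subspace_diff[OF subspace_ideal _ d]
      by (metis (no_types, lifting) image_cong_simp image_subset_iff rev_image_eqI subset_antisym)
  qed
qed

lemma rc_hom: "ring_hom_ring (mpoly_ring r) (quot_alg r I) rc"
  using J.rcos_ring_hom_ring unfolding quot_alg_def residue_class_def .

interpretation H: ring_hom_ring "mpoly_ring r" "quot_alg r I" rc by (rule rc_hom)

lemma rc_add: "p \<in> polys r \<Longrightarrow> q \<in> polys r \<Longrightarrow> rc (p + q) = rc p \<oplus>\<^bsub>quot_alg r I\<^esub> rc q"
  and rc_mult: "p \<in> polys r \<Longrightarrow> q \<in> polys r \<Longrightarrow> rc (p * q) = rc p \<otimes>\<^bsub>quot_alg r I\<^esub> rc q"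
  and rc_0: "rc 0 = \<zero>\<^bsub>quot_alg r I\<^esub>"
  using H.hom_add[of p q] H.hom_mult[of p q] H.hom_zero by simp_all

lemma subfield_base: "subfield (base_field r I) (quot_alg r I)"
proof -
  have "rc 1 \<noteq> rc 0" using rc_eq_iff[of 1 0] one_not_in_ideal by simp
  then have "\<one>\<^bsub>quot_alg r I\<^esub> \<noteq> \<zero>\<^bsub>quot_alg r I\<^esub>" using H.hom_one rc_0 by simp
  from H.img_is_subfield(2)[OF subfield_constants this]
  show ?thesis unfolding base_field_def by (simp add: image_image)
qed

lemma rc_eq_0_iff: "p \<in> polys r \<Longrightarrow> rc p = \<zero>\<^bsub>quot_alg r I\<^esub> \<longleftrightarrow> p \<in> I"
  using rc_eq_iff[of p 0] rc_0 by simp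

lemma rc_scal_add:
  assumes "p \<in> polys r" "q \<in> polys r"
  shows "rc (scal c p + q) =
    rc (Poly_Mapping.single 0 c) \<otimes>\<^bsub>quot_alg r I\<^esub> rc p \<oplus>\<^bsub>quot_alg r I\<^esub> rc q"
  using rc_add[OF polys_closed(7)[OF assms(1)] assms(2), of c] rc_mult[OF polys_closed(8) assms(1), of c]
  by (simp add: scal_def)

text \<open>This links the dimension of subspaces of polynomials to the inductive
  \<open>dimension\<close> in the quotient ring: each basis vector gives one line extension, and its
  class is new because the span meets \<open>I\<close> only in 0.\<close>

lemma dimension_rc_span:
  assumes "finite B" "mp.independent B" "B \<subseteq> polys r" "mp.span B \<inter> I \<subseteq> {0}"
  shows "ring.dimension (quot_alg r I) (card B) (base_field r I) (rc ` mp.span B)"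
  using assms
proof (induction B rule: finite_induct)
  case empty
  then show ?case using Q.zero_dim rc_0 by simp
next
  case (insert b B)
  have b: "b \<in> polys r" and B: "B \<subseteq> polys r" using insert by auto
  have span_polys: "mp.span B \<subseteq> polys r" using B by (intro mp.span_minimal) auto
  have bB: "b \<notin> mp.span B" "mp.independent B"
    using insert.prems(1) insert.hyps(2) by (simp_all add: mp.independent_insert)
  have IH: "ring.dimension (quot_alg r I) (card B) (base_field r I) (rc ` mp.span B)"
    using insert bB(2) B mp.span_mono[of B "insert b B"] by blast
  have "rc b \<notin> rc ` mp.span B"
  proof
    assume "rc b \<in> rc ` mp.span B"
    then obtain v where v: "v \<in> mp.span B" "rc b = rc v" by blast
    then have "b - v \<in> I" using rc_eq_iff b span_polys by blast
    moreover have "b - v \<in> mp.span (insert b B)"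
      using subsetD[OF mp.span_mono[OF subset_insertI] v(1)] by (intro mp.span_diff) (simp_all add: mp.span_base)
    ultimately have "b = v" using insert.prems(3) by auto
    then show False using v bB by simp
  qed
  then have "ring.dimension (quot_alg r I) (Suc (card B)) (base_field r I)
      (ring.line_extension (quot_alg r I) (base_field r I) (rc b) (rc ` mp.span B))"
    using Q.Suc_dim[OF _ _ IH] H.hom_closed b by simp
  moreover have "ring.line_extension (quot_alg r I) (base_field r I) (rc b) (rc ` mp.span B)
      = rc ` mp.span (insert b B)"
  proof (rule equalityI; rule subsetI)
    fix u assume "u \<in> ring.line_extension (quot_alg r I) (base_field r I) (rc b) (rc ` mp.span B)"
    then obtain c v where cv: "v \<in> mp.span B"
      "u = rc (Poly_Mapping.single 0 c) \<otimes>\<^bsub>quot_alg r I\<^esub> rc b \<oplus>\<^bsub>quot_alg r I\<^esub> rc v"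
      unfolding Q.line_extension_mem_iff base_field_def by blast
    then have "u = rc (scal c b + v)"
      using rc_scal_add[OF b subsetD[OF span_polys cv(1)], of c] by simp
    moreover have "scal c b + v \<in> mp.span (insert b B)"
      using subsetD[OF mp.span_mono[OF subset_insertI] cv(1)] scal_in_span by (intro mp.span_add)
    ultimately show "u \<in> rc ` mp.span (insert b B)" by blast
  next
    fix u assume "u \<in> rc ` mp.span (insert b B)"
    then obtain v c where v: "u = rc v" "v - scal c b \<in> mp.span B"
      unfolding mp.span_insert by blast
    have "rc v = rc (scal c b + (v - scal c b))" by simp
    then have "u = rc (Poly_Mapping.single 0 c) \<otimes>\<^bsub>quot_alg r I\<^esub> rc b \<oplus>\<^bsub>quot_alg r I\<^esub> rc (v - scal c b)"
      using rc_scal_add[OF b subsetD[OF span_polys v(2)], of c] v(1) by simp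
    then show "u \<in> ring.line_extension (quot_alg r I) (base_field r I) (rc b) (rc ` mp.span B)"
      unfolding Q.line_extension_mem_iff base_field_def using v(2) by blast
  qed
  ultimately show ?case using insert.hyps by simp
qed

text \<open>A linear normal form modulo \<open>I\<close>. It need not preserve degrees; since its
  kernel is \<open>I\<close>, the image of the forms of degree \<open>d\<close> is a copy of the
  degree \<open>d\<close> piece of the quotient.\<close>

definition nf :: "'k mpoly \<Rightarrow> 'k mpoly" where
  "nf = (SOME f. Vector_Spaces.linear scal scal f \<and> (\<forall>x. f x = 0 \<longleftrightarrow> x \<in> I) \<and> (\<forall>x. x - f x \<in> I))"

lemma nf_linear: "Vector_Spaces.linear scal scal nf"
  and nf_eq_0_iff: "nf p = 0 \<longleftrightarrow> p \<in> I"
  and nf_diff: "p - nf p \<in> I"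
proof -
  have "\<exists>f. Vector_Spaces.linear scal scal f \<and> (\<forall>x. f x = 0 \<longleftrightarrow> x \<in> I) \<and> (\<forall>x. x - f x \<in> I)"
    using mp.linear_projection_along[OF subspace_ideal] by metis
  from someI_ex[OF this, folded nf_def]
  show "Vector_Spaces.linear scal scal nf" "nf p = 0 \<longleftrightarrow> p \<in> I" "p - nf p \<in> I" by blast+
qed

lemma nf_add: "nf (p + q) = nf p + nf q"
  and nf_scal: "nf (scal c p) = scal c (nf p)"
  using nf_linear unfolding Vector_Spaces.linear_iff by blast+

lemma nf_minus: "nf (p - q) = nf p - nf q"
  using nf_add[of "p - q" q] by (simp add: algebra_simps)

lemma nf_eq: "p - q \<in> I \<Longrightarrow> nf p = nf q"
  using nf_eq_0_iff[of "p - q"] nf_minus[of p q] by simp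

lemma nf_nf: "nf (nf p) = nf p"
  using nf_eq[OF nf_diff] by simp

lemma nf_polys: "p \<in> polys r \<Longrightarrow> nf p \<in> polys r"
proof -
  assume "p \<in> polys r"
  moreover have "p - nf p \<in> polys r" using nf_diff ideal_polys by blast
  ultimately have "p - (p - nf p) \<in> polys r" by blast
  then show ?thesis by simp
qed

definition H :: "int \<Rightarrow> nat" where
  "H d = mp.dim (nf ` forms r d)"

lemma nf_forms: "mp.subspace (nf ` forms r d)" "finspan mp.span (nf ` forms r d)"
  and dim_forms_nf: "num_forms r d = mp.dim (I \<inter> forms r d) + H d"
proof -
  note rn = mp.rank_nullity_linear[OF subspace_forms finspan_forms nf_linear, of r d]
  show "mp.subspace (nf ` forms r d)" "finspan mp.span (nf ` forms r d)" by (fact rn)+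
  have "{v \<in> forms r d. nf v = 0} = I \<inter> forms r d" using nf_eq_0_iff by blast
  then show "num_forms r d = mp.dim (I \<inter> forms r d) + H d"
    using rn(1) dim_forms_int[of r d, where 'k = 'k] unfolding H_def by simp
qed

text \<open>The image of the forms under \<open>nf\<close> meets \<open>I\<close> only in 0, because
  \<open>nf\<close> is idempotent with kernel \<open>I\<close>; a basis of that image therefore
  yields a basis of the graded piece.\<close>

lemma hilb_eq: "hilb r I d = H (int d)"
proof -
  let ?V = "nf ` forms r (int d)"
  obtain B where B: "finite B" "mp.independent B" "B \<subseteq> ?V" "mp.span B = ?V" "card B = mp.dim ?V"
    by (rule mp.fin_dim_basis[OF nf_forms(2,1), of "int d"])
  have V: "?V \<subseteq> polys r" using nf_polys forms_subset_polys by blast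
  have disj: "v = 0" if "v \<in> ?V" "v \<in> I" for v
  proof -
    obtain p where "v = nf p" using \<open>v \<in> ?V\<close> by blast
    then show ?thesis using nf_eq_0_iff[of v] that(2) nf_nf by simp
  qed
  have "mp.span B \<inter> I \<subseteq> {0}" unfolding B(4) using disj by blast
  then have "ring.dimension (quot_alg r I) (card B) (base_field r I) (rc ` ?V)"
    using dimension_rc_span[OF B(1,2)] B(3) V unfolding B(4) by simp
  moreover have "rc ` ?V = graded_piece r I d"
  proof -
    have "rc (nf p) = rc p" if "p \<in> forms r (int d)" for p
    proof -
      have "p \<in> polys r" using that forms_subset_polys by blast
      then have "rc p = rc (nf p)" using rc_eq_iff[of p "nf p"] nf_polys nf_diff by simp
      then show ?thesis by simp
    qed
    then show ?thesis unfolding graded_piece_def image_image by simp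
  qed
  ultimately have dim: "ring.dimension (quot_alg r I) (card B) (base_field r I) (graded_piece r I d)"
    by simp
  then have "kdim r I (graded_piece r I d) = card B"
    unfolding kdim_def using Q.dimension_is_inj[OF subfield_base] by (intro the_equality) auto
  then show ?thesis unfolding hilb_def H_def using B(5) by simp
qed

lemma H_eq_0: "forms r d \<subseteq> I \<Longrightarrow> H d = 0"
proof -
  assume "forms r d \<subseteq> I"
  then have "nf ` forms r d \<subseteq> {0}" using nf_eq_0_iff by blast
  from mp.dim_mono_fin[OF mp.fin_dim_zero this] show ?thesis unfolding H_def by simp
qed

lemma ideal_forms_trivial:
  assumes "H d = num_forms r d"
  shows "I \<inter> forms r d \<subseteq> {0}"
proof (rule mp.fin_dim_dim_eq_0)
  show "finspan mp.span (I \<inter> forms r d)"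
    by (rule mp.fin_dim_subset[OF finspan_forms[of r d]]) simp
  show "mp.dim (I \<inter> forms r d) = 0" using dim_forms_nf[of d] assms by simp
qed

lemma graded_piece_trivial_iff:
  "graded_piece r I d = {\<zero>\<^bsub>quot_alg r I\<^esub>} \<longleftrightarrow> forms r (int d) \<subseteq> I"
proof -
  have "rc p = \<zero>\<^bsub>quot_alg r I\<^esub> \<longleftrightarrow> p \<in> I" if "p \<in> forms r (int d)" for p
    using that rc_eq_0_iff forms_subset_polys by blast
  moreover have "forms r (int d) \<noteq> {}" using mp.subspace_0[OF subspace_forms] by blast
  ultimately show ?thesis unfolding graded_piece_def by auto
qed

text \<open>The classes of polynomials of order at least \<open>n\<close> form a descending chain of
  ideals, which stabilises. A form of large degree \<open>d\<close> is then congruent modulo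
  \<open>I\<close> to a polynomial of order above \<open>d\<close>, and taking components of degree
  \<open>d\<close> puts the form into \<open>I\<close>.\<close>

lemma forms_eventually_in_ideal: "\<exists>n. \<forall>d\<ge>n. forms r (int d) \<subseteq> I"
proof -
  define T :: "nat \<Rightarrow> 'k mpoly set" where "T n = {p \<in> polys r. \<forall>m. lkp p m \<noteq> 0 \<longrightarrow> n \<le> mono_degree m}" for n
  have Tc: "T n \<subseteq> polys r" "0 \<in> T n" for n by (auto simp: T_def)
  have T_add: "p + q \<in> T n" if "p \<in> T n" "q \<in> T n" for p q n
  proof -
    have "n \<le> mono_degree m" if "lkp (p + q) m \<noteq> 0" for m
    proof (cases "lkp p m = 0")
      case True
      then show ?thesis using that \<open>q \<in> T n\<close> by (simp add: T_def lookup_add)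
    qed (use \<open>p \<in> T n\<close> in \<open>simp add: T_def\<close>)
    then show ?thesis using that unfolding T_def by auto
  qed
  have T_uminus: "- p \<in> T n" if "p \<in> T n" for p n
    using that unfolding T_def by auto
  have T_mult: "p * q \<in> T n" if p: "p \<in> polys r" and q: "q \<in> T n" for p q n
  proof -
    have "n \<le> mono_degree m" if "lkp (p * q) m \<noteq> 0" for m
    proof -
      have "m \<in> keys (p * q)" using that by (simp add: in_keys_iff)
      then obtain a b where "b \<in> keys q" "m = a + b" using subsetD[OF keys_mult] by blast
      then show ?thesis using q by (auto simp: T_def mono_degree_add in_keys_iff intro: trans_le_add2)
    qed
    then show ?thesis using p q unfolding T_def by auto
  qed
  have id: "ideal (rc ` T n) (quot_alg r I)" for n
  proof (rule idealI)
    show "ring (quot_alg r I)" by (rule Q.ring_axioms)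
    show "subgroup (rc ` T n) (add_monoid (quot_alg r I))"
    proof (rule subgroup.intro)
      show "rc ` T n \<subseteq> carrier (add_monoid (quot_alg r I))"
        using H.hom_closed subsetD[OF Tc(1)] by auto
      show "x \<otimes>\<^bsub>add_monoid (quot_alg r I)\<^esub> y \<in> rc ` T n" if xy: "x \<in> rc ` T n" "y \<in> rc ` T n" for x y
      proof -
        obtain p q where pq: "p \<in> T n" "x = rc p" "q \<in> T n" "y = rc q" using xy by blast
        then have "x \<otimes>\<^bsub>add_monoid (quot_alg r I)\<^esub> y = rc (p + q)"
          using rc_add[of p q] Tc(1) by auto
        then show ?thesis using T_add[OF pq(1,3)] by blast
      qed
      show "\<one>\<^bsub>add_monoid (quot_alg r I)\<^esub> \<in> rc ` T n"
        using Tc(2) rc_0 by (auto intro!: image_eqI[of _ _ 0])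
      show "inv\<^bsub>add_monoid (quot_alg r I)\<^esub> x \<in> rc ` T n" if x: "x \<in> rc ` T n" for x
      proof -
        obtain p where p: "p \<in> T n" "x = rc p" using x by blast
        have pp: "p \<in> polys r" using p(1) Tc(1) by blast
        then have "rc (- p) \<oplus>\<^bsub>quot_alg r I\<^esub> rc p = \<zero>\<^bsub>quot_alg r I\<^esub>"
          using rc_add[of "- p" p] rc_0 by simp
        then have "\<ominus>\<^bsub>quot_alg r I\<^esub> x = rc (- p)"
          unfolding p(2) using pp H.hom_closed by (intro Q.minus_equality) auto
        then show ?thesis using T_uminus[OF p(1)] unfolding a_inv_def by auto
      qed
    qed
    fix a x assume a: "a \<in> rc ` T n" and x: "x \<in> carrier (quot_alg r I)"
    obtain q where q: "q \<in> T n" "a = rc q" using a by blast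
    have qp: "q \<in> polys r" using q(1) Tc(1) by blast
    obtain p where p: "p \<in> polys r" "x = rc p"
      using x unfolding quot_alg_def FactRing_def A_RCOSETS_def' residue_class_def by auto
    show "x \<otimes>\<^bsub>quot_alg r I\<^esub> a \<in> rc ` T n"
      unfolding p q(2) using rc_mult[OF p(1) qp] imageI[OF T_mult[OF p(1) q(1)], of rc] by simp
    show "a \<otimes>\<^bsub>quot_alg r I\<^esub> x \<in> rc ` T n"
      unfolding p q(2) using rc_mult[OF qp p(1)] imageI[OF T_mult[OF p(1) q(1)], of rc]
      by (simp add: mult.commute)
  qed
  have dec: "rc ` T (Suc n) \<subseteq> rc ` T n" for n
    unfolding T_def by (auto dest: Suc_leD)
  have "\<exists>n. \<forall>m\<ge>n. rc ` T m = rc ` T n"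
    by (rule artinian[unfolded artinian_ring_def, rule_format]) (use id dec in simp)
  then obtain n where n: "\<And>m. m \<ge> n \<Longrightarrow> rc ` T m = rc ` T n" by blast
  have "f \<in> I" if f: "f \<in> forms r (int d)" and d: "d \<ge> n" for f d
  proof -
    have fp: "f \<in> polys r" using f forms_subset_polys by blast
    have "f \<in> T d" using f fp unfolding T_def mem_forms by auto
    then have "rc f \<in> rc ` T (Suc d)" using n[of d] n[of "Suc d"] d by auto
    then obtain q where q: "q \<in> T (Suc d)" "rc f = rc q" by blast
    then have "f - q \<in> I" using rc_eq_iff fp Tc(1) by blast
    then have "hcomp (int d) (f - q) \<in> I" by (rule homogeneous)
    moreover have "hcomp (int d) (f - q) = f"
    proof (rule poly_mapping_eqI)
      fix m
      have "lkp f m = 0" if "int (mono_degree m) \<noteq> int d" using f that unfolding mem_forms by blast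
      moreover have "lkp q m = 0" if "mono_degree m = d" using q(1) that unfolding T_def by force
      ultimately show "lkp (hcomp (int d) (f - q)) m = lkp f m"
        by (cases "mono_degree m = d") (simp_all add: lookup_minus)
    qed
    ultimately show ?thesis by simp
  qed
  then show ?thesis by blast
qed

lemma socle_degree_props:
  "\<not> forms r (int (socle_degree r I)) \<subseteq> I"
  "d > socle_degree r I \<Longrightarrow> forms r (int d) \<subseteq> I"
proof -
  obtain n where n: "\<And>d. d \<ge> n \<Longrightarrow> forms r (int d) \<subseteq> I" using forms_eventually_in_ideal by blast
  have eq: "socle_degree r I = (GREATEST d. \<not> forms r (int d) \<subseteq> I)"
    unfolding socle_degree_def graded_piece_trivial_iff ..
  have ex: "\<not> forms r (int 0) \<subseteq> I" using one_not_in_ideal one_forms[of r] by (auto simp del: one_forms)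
  have bd: "d \<le> n" if "\<not> forms r (int d) \<subseteq> I" for d using n that by (meson nat_le_linear)
  show "\<not> forms r (int (socle_degree r I)) \<subseteq> I"
    unfolding eq by (rule GreatestI_nat[where P = "\<lambda>d. \<not> forms r (int d) \<subseteq> I", OF ex bd])
  show "forms r (int d) \<subseteq> I" if "d > socle_degree r I"
    using Greatest_le_nat[where P = "\<lambda>d. \<not> forms r (int d) \<subseteq> I", OF _ bd, of d] that
    unfolding eq by (meson not_less)
qed

text \<open>The pieces are indexed by the distance \<open>k\<close> below \<open>p\<close>, so that
  multiplication by a variable lowers the index; a common kernel element would be a socle element in
  a degree below \<open>p\<close>.\<close>

lemma hilbert_growth:
  assumes "\<And>d f. d < p \<Longrightarrow> f \<in> forms r d \<Longrightarrow> (\<And>k. k < r \<Longrightarrow> var k * f \<in> I) \<Longrightarrow> f \<in> I"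
  shows "Suc k * H (p - int (Suc k)) \<le> (k + r) * H (p - int k)"
proof -
  \<comment> \<open>The operators have to be linear for every index, so indices from
    \<open>r\<close> on get the zero map.\<close>
  define x where "x i = (if i < r then var i else 0 :: 'k mpoly)" for i
  have xp: "x i \<in> polys r" for i by (simp add: x_def)
  let ?X = "\<lambda>i v. nf (x i * v)"
  let ?U = "\<lambda>k. nf ` forms r (p - int k)"
  have Xnf: "nf (q * nf v) = nf (q * v)" if "q \<in> polys r" for q v
  proof -
    have "q * (v - nf v) \<in> I" using ideal_mult[OF that nf_diff] .
    then show ?thesis by (intro nf_eq[symmetric]) (simp add: algebra_simps)
  qed
  have "Suc k * mp.dim (?U (Suc k)) \<le> (k + r) * mp.dim (?U k)"
  proof (rule mp.commuting_family_growth[where X = ?X and U = ?U])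
    show "Vector_Spaces.linear scal scal (?X i)" for i
      unfolding Vector_Spaces.linear_iff using mp.vector_space_axioms
      by (simp add: distrib_left nf_add nf_scal scal_mult_right[symmetric])
    show "mp.subspace (?U k)" "finspan mp.span (?U k)" for k
      by (rule nf_forms)+
    show "?X i ` ?U (Suc k) \<subseteq> ?U k" if "i < r" for i k
    proof
      fix y assume "y \<in> ?X i ` ?U (Suc k)"
      then obtain q where q: "q \<in> forms r (p - int (Suc k))" "y = nf (x i * nf q)" by blast
      have "x i * q \<in> forms r (p - int k)"
        using forms_mult[OF var_forms[OF that] q(1)] that by (simp add: x_def)
      then show "y \<in> ?U k" using q(2) Xnf[OF xp] by auto
    qed
    show "?X i (?X j v) = ?X j (?X i v)" if "v \<in> ?U k" for i j k v
      using Xnf[OF xp] by (simp add: mult.left_commute)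
    show "v = 0" if v: "v \<in> ?U (Suc k)" and z: "\<And>i. i < r \<Longrightarrow> ?X i v = 0" for k v
    proof -
      obtain q where q: "q \<in> forms r (p - int (Suc k))" "v = nf q" using v by blast
      have "q \<in> I"
      proof (rule assms[OF _ q(1)])
        show "var i * q \<in> I" if "i < r" for i
          using z[OF that] Xnf[of "var i" q] that q(2) nf_eq_0_iff[of "var i * q"] by (simp add: x_def)
      qed simp
      then show ?thesis using q(2) nf_eq_0_iff by simp
    qed
  qed
  then show ?thesis by (simp add: H_def)
qed

end

section \<open>Numerical estimates\<close>

definition nz :: "int \<Rightarrow> int" where
  "nz d = (if d < 0 then 0 else (d + 1) * (d + 2) div 2)"

lemma nz_neg: "d < 0 \<Longrightarrow> nz d = 0"
  by (simp add: nz_def)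

text \<open>The polynomial vanishes at -1 and -2, so it still describes \<open>nz\<close> there.
  This range suffices for third differences in all positive degrees.\<close>

lemma two_nz: "- 2 \<le> d \<Longrightarrow> 2 * nz d = (d + 1) * (d + 2)"
proof -
  assume d: "- 2 \<le> d"
  show ?thesis
  proof (cases "d < 0")
    case True
    then have "d = - 1 \<or> d = - 2" using d by auto
    then show ?thesis by (auto simp: nz_def)
  next
    case False
    have "even ((d + 1) * (d + 2))" by simp
    then show ?thesis using False by (simp add: nz_def)
  qed
qed

lemma num_forms_3: "int (num_forms 3 d) = nz d"
proof (cases "d < 0")
  case False
  then obtain n where n: "d = int n" using zero_le_imp_eq_int by (metis not_less)
  have "num_monos 3 n = (n + 2) choose 2"
  proof -
    have "3 + n - 1 = n + 2" by simp
    then show ?thesis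
      unfolding num_monos_def using binomial_symmetric[of n "n + 2"] by (metis add_diff_cancel_left' le_add1)
  qed
  then show ?thesis
    unfolding num_forms_def nz_def n
    by (simp add: choose_two algebra_simps zdiv_int)
qed (simp add: num_forms_def nz_def)

text \<open>The coefficient of degree \<open>d\<close> after multiplying the generating series by
  \<open>(1 - t)^3\<close>, which turns the series of \<open>nz\<close> into 1.\<close>

definition diff3 :: "(int \<Rightarrow> int) \<Rightarrow> int \<Rightarrow> int" where
  "diff3 f d = f d - 3 * f (d - 1) + 3 * f (d - 2) - f (d - 3)"

lemma diff3_nz: "diff3 nz d = (if d = 0 then 1 else 0)"
proof -
  consider "d < 0" | "d = 0" | "d \<ge> 1" by linarith
  then show ?thesis
  proof cases
    case 3
    then have "2 * diff3 nz d = 0"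
      using two_nz[of d] two_nz[of "d - 1"] two_nz[of "d - 2"] two_nz[of "d - 3"]
      unfolding diff3_def by (simp add: algebra_simps)
    then show ?thesis using 3 by simp
  qed (auto simp: diff3_def nz_def)
qed

lemma diff3_sum_list: "diff3 (\<lambda>d. \<Sum>j\<leftarrow>L. nz (d - j)) d = int (count_list L d)"
proof (induction L)
  case (Cons j L)
  have "diff3 (\<lambda>d. \<Sum>j\<leftarrow>j # L. nz (d - j)) d = diff3 nz (d - j) + diff3 (\<lambda>d. \<Sum>j\<leftarrow>L. nz (d - j)) d"
    by (simp add: diff3_def algebra_simps)
  then show ?case using Cons.IH by (auto simp: diff3_nz)
qed (simp add: diff3_def)

lemma sum_nz: "- 1 \<le> t \<Longrightarrow> 6 * (\<Sum>i\<in>{0..t}. nz i) = (t + 1) * (t + 2) * (t + 3)"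
proof (induction t rule: int_ge_induct)
  case (step t)
  have "{0..t + 1} = insert (t + 1) {0..t}" using step.hyps by auto
  then have "6 * (\<Sum>i\<in>{0..t + 1}. nz i) = 3 * (2 * nz (t + 1)) + 6 * (\<Sum>i\<in>{0..t}. nz i)" by simp
  then show ?case using step two_nz[of "t + 1"] by (simp add: algebra_simps)
qed simp

lemma sum_nz_reversed:
  assumes "b \<le> j" "j \<le> c"
  shows "6 * (\<Sum>i\<in>{b..c}. nz (j - i)) = (j - b + 1) * (j - b + 2) * (j - b + 3)"
proof -
  have "(\<Sum>i\<in>{b..c}. nz (j - i)) = (\<Sum>i\<in>{b..j}. nz (j - i))"
    using assms by (intro sum.mono_neutral_right) (auto simp: nz_neg)
  also have "\<dots> = (\<Sum>i\<in>{0..j - b}. nz i)"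
    by (rule sum.reindex_bij_witness[of _ "\<lambda>i. j - i" "\<lambda>i. j - i"]) auto
  finally show ?thesis using sum_nz[of "j - b"] assms by simp
qed

lemma mult_mono3_int:
  fixes x y z :: int
  assumes "x \<le> x'" "y \<le> y'" "z \<le> z'" "0 \<le> x" "0 \<le> y" "0 \<le> z"
  shows "x * y * z \<le> x' * y' * z'"
  using assms by (intro mult_mono mult_nonneg_nonneg) auto

text \<open>\<open>h\<close> is the Hilbert function of a compressed algebra with socle-vector \<open>s\<close> and initial
  degree \<open>b\<close>; \<open>D 1\<close>, \<open>D 2\<close>, \<open>D 3\<close> are the shifts of a resolution with that Hilbert function.\<close>

locale compressed_shifts =
  fixes h s :: "int \<Rightarrow> int" and b c :: int and D :: "nat \<Rightarrow> int list"
  assumes b1: "1 \<le> b" and bc: "b \<le> c" and s0: "\<And>j. 0 \<le> s j"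
    and h_nonneg: "\<And>i. 0 \<le> h i"
    and h_low: "\<And>i. i < b \<Longrightarrow> h i = nz i"
    and h_high: "\<And>i. b \<le> i \<Longrightarrow> h i = (\<Sum>j\<in>{b..c}. s j * nz (j - i))"
    and h_b: "h b \<le> nz b"
    and second: "nz (b - 1) < (\<Sum>j\<in>{b..c}. s j * nz (j - b + 1))"
    and D1: "\<And>j. j \<in> set (D 1) \<Longrightarrow> b \<le> j"
    and D12: "\<And>j. j \<in> set (D 2) \<Longrightarrow> \<exists>j'\<in>set (D 1). j' < j"
    and D23: "\<And>j. j \<in> set (D 3) \<Longrightarrow> \<exists>j'\<in>set (D 2). j' < j"
    and euler: "\<And>d. diff3 h d = (if d = 0 then 1 else 0) - int (count_list (D 1) d)
        + int (count_list (D 2) d) - int (count_list (D 3) d)"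
    and top: "c + 3 \<in> set (D 3)"
    and growth: "\<And>p k. (\<And>d. d < p \<Longrightarrow> d + 3 \<notin> set (D 3)) \<Longrightarrow>
        int (Suc k) * h (p - int (Suc k)) \<le> (int k + 3) * h (p - int k)"
begin

lemma D2_lower: "j \<in> set (D 2) \<Longrightarrow> b + 1 \<le> j"
  using D12 D1 by fastforce

lemma D3_lower: "j \<in> set (D 3) \<Longrightarrow> b + 2 \<le> j"
  using D23 D2_lower by fastforce

lemma count_eq_0: "j \<notin> set L \<Longrightarrow> count_list L j = 0"
  by (simp add: count_list_0_iff)

text \<open>Each function \<open>nz (j - i)\<close> of \<open>i\<close> has third difference 0 at
  \<open>b + 2\<close> once its value at \<open>b - 1\<close> is included. What remains is that
  value, summed, minus \<open>nz (b - 1)\<close>, which is positive by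
  \<open>second\<close>.\<close>

lemma mem_D2: "b + 2 \<in> set (D 2)"
proof -
  have "diff3 h (b + 2) = (\<Sum>j\<in>{b..c}. s j * nz (j - (b + 2))) - 3 * (\<Sum>j\<in>{b..c}. s j * nz (j - (b + 1)))
      + 3 * (\<Sum>j\<in>{b..c}. s j * nz (j - b)) - nz (b - 1)"
  proof -
    have "diff3 h (b + 2) = h (b + 2) - 3 * h (b + 1) + 3 * h b - h (b - 1)"
      by (simp add: diff3_def add.commute)
    then show ?thesis
      using h_high[of "b + 2"] h_high[of "b + 1"] h_high[of b] h_low[of "b - 1"] by linarith
  qed
  also have "\<dots> = (\<Sum>j\<in>{b..c}. s j * (nz (j - b + 1) - diff3 nz (j - b + 1))) - nz (b - 1)"
    by (simp add: diff3_def sum_distrib_left sum.distrib[symmetric] sum_subtractf[symmetric] algebra_simps)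
  also have "(\<Sum>j\<in>{b..c}. s j * (nz (j - b + 1) - diff3 nz (j - b + 1))) = (\<Sum>j\<in>{b..c}. s j * nz (j - b + 1))"
    by (intro sum.cong) (auto simp: diff3_nz)
  finally have "0 < diff3 h (b + 2)" using second by simp
  then have "0 < count_list (D 2) (b + 2)" using euler[of "b + 2"] b1 by simp
  then show ?thesis using count_eq_0 by (metis less_irrefl)
qed

lemma diff3_b1: "diff3 h (b + 1) = h (b + 1) - 3 * h b + b * (b + 2)"
proof -
  have "2 * (3 * nz (b - 1) - nz (b - 2)) = 2 * (b * (b + 2))"
    using two_nz[of "b - 1"] two_nz[of "b - 2"] b1 by (simp add: algebra_simps)
  then show ?thesis using h_low[of "b - 1"] h_low[of "b - 2"] by (simp add: diff3_def)
qed

text \<open>Six times the multiplicity, so that all estimates stay in the integers.\<close>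

definition e6 :: int where "e6 = 6 * (\<Sum>i\<in>{0..c}. h i)"

text \<open>Below \<open>b\<close> the sum is the one of \<open>nz\<close>. The split is used at
  \<open>b\<close> and also at \<open>b - 1\<close>.\<close>

lemma e6_split:
  assumes "0 \<le> a" "a \<le> b"
  shows "e6 = a * (a + 1) * (a + 2) + 6 * (\<Sum>i\<in>{a..c}. h i)"
proof -
  have "{0..c} = {0..a - 1} \<union> {a..c}" using assms bc by auto
  then have "(\<Sum>i\<in>{0..c}. h i) = (\<Sum>i\<in>{0..a - 1}. h i) + (\<Sum>i\<in>{a..c}. h i)"
    by (simp add: sum.union_disjoint)
  moreover have "(\<Sum>i\<in>{0..a - 1}. h i) = (\<Sum>i\<in>{0..a - 1}. nz i)"
    using h_low assms by (intro sum.cong) auto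
  ultimately show ?thesis using sum_nz[of "a - 1"] assms unfolding e6_def by (simp add: algebra_simps)
qed

lemma sum_high: "6 * (\<Sum>i\<in>{b..c}. h i) = (\<Sum>j\<in>{b..c}. s j * ((j - b + 1) * (j - b + 2) * (j - b + 3)))"
proof -
  have "6 * (\<Sum>i\<in>{b..c}. h i) = 6 * (\<Sum>i\<in>{b..c}. \<Sum>j\<in>{b..c}. s j * nz (j - i))"
    using h_high by (intro arg_cong[where f = "\<lambda>x. 6 * x"] sum.cong) auto
  also have "\<dots> = (\<Sum>j\<in>{b..c}. s j * (6 * (\<Sum>i\<in>{b..c}. nz (j - i))))"
    by (subst sum.swap) (simp add: sum_distrib_left algebra_simps)
  also have "\<dots> = (\<Sum>j\<in>{b..c}. s j * ((j - b + 1) * (j - b + 2) * (j - b + 3)))"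
    by (intro sum.cong refl) (simp add: sum_nz_reversed)
  finally show ?thesis .
qed

text \<open>For each \<open>j\<close> the last factor in \<open>sum_high\<close> is raised to
  \<open>c - b + 3\<close>; the other two make \<open>2 * nz (j - b)\<close>, which sums to
  \<open>2 * h b\<close>.\<close>

lemma sum_high_le: "6 * (\<Sum>i\<in>{b..c}. h i) \<le> (c - b + 3) * (2 * h b)"
proof -
  have "(\<Sum>j\<in>{b..c}. s j * ((j - b + 1) * (j - b + 2) * (j - b + 3)))
      \<le> (\<Sum>j\<in>{b..c}. s j * ((c - b + 3) * (2 * nz (j - b))))"
  proof (intro sum_mono mult_left_mono s0)
    fix j assume j: "j \<in> {b..c}"
    have "2 * nz (j - b) = (j - b + 1) * (j - b + 2)" using j two_nz[of "j - b"] by simp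
    moreover have "(j - b + 1) * (j - b + 2) * (j - b + 3) \<le> (j - b + 1) * (j - b + 2) * (c - b + 3)"
      using j by (intro mult_left_mono) auto
    ultimately show "(j - b + 1) * (j - b + 2) * (j - b + 3) \<le> (c - b + 3) * (2 * nz (j - b))"
      by (simp add: mult.commute)
  qed
  also have "\<dots> = (c - b + 3) * (2 * h b)"
    using h_high[of b] by (simp add: sum_distrib_left algebra_simps)
  finally show ?thesis unfolding sum_high .
qed

text \<open>Here the middle factor is raised, to \<open>c - b + 2\<close>. The outer two make
  \<open>3 * nz (j - b) - nz (j - (b + 1))\<close>, which sums to the expression controlled by the
  third difference at \<open>b + 1\<close>.\<close>

lemma sum_high_le': "6 * (\<Sum>i\<in>{b..c}. h i) \<le> (c - b + 2) * (3 * h b - h (b + 1))"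
proof -
  have "(\<Sum>j\<in>{b..c}. s j * ((j - b + 1) * (j - b + 2) * (j - b + 3)))
      \<le> (\<Sum>j\<in>{b..c}. s j * ((c - b + 2) * (3 * nz (j - b) - nz (j - (b + 1)))))"
  proof (intro sum_mono mult_left_mono s0)
    fix j assume j: "j \<in> {b..c}"
    have "2 * (3 * nz (j - b) - nz (j - (b + 1))) = 2 * ((j - b + 1) * (j - b + 3))"
      using j two_nz[of "j - b"] two_nz[of "j - (b + 1)"] by (simp add: algebra_simps)
    then have "3 * nz (j - b) - nz (j - (b + 1)) = (j - b + 1) * (j - b + 3)" by simp
    moreover have "((j - b + 1) * (j - b + 3)) * (j - b + 2) \<le> ((j - b + 1) * (j - b + 3)) * (c - b + 2)"
      using j by (intro mult_left_mono) auto
    ultimately show "(j - b + 1) * (j - b + 2) * (j - b + 3) \<le> (c - b + 2) * (3 * nz (j - b) - nz (j - (b + 1)))"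
      by (simp only: mult.commute mult.left_commute)
  qed
  also have "\<dots> = (c - b + 2) * (3 * h b - h (b + 1))"
    using h_high[of b] h_high[of "b + 1"]
    by (simp add: sum_distrib_left sum_subtractf[symmetric] algebra_simps)
  finally show ?thesis unfolding sum_high .
qed

lemma nonempty: "set (D 1) \<noteq> {}" "set (D 2) \<noteq> {}" "set (D 3) \<noteq> {}"
  using mem_D2 D12 top by auto

section \<open>The upper bound for the multiplicity\<close>

theorem upper_bound: "e6 \<le> Max (set (D 1)) * Max (set (D 2)) * Max (set (D 3))"
proof -
  let ?M = "\<lambda>i. Max (set (D i))"
  have M3: "c + 3 \<le> ?M 3" using top by simp
  have M2: "b + 2 \<le> ?M 2" using mem_D2 by simp
  have M1: "b \<le> ?M 1" using D1 nonempty(1) by (meson List.finite_set Max_in)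
  show ?thesis
  proof (cases "b + 1 \<le> ?M 1")
    case True
    have "e6 \<le> b * (b + 1) * (b + 2) + (c - b + 3) * (2 * h b)"
      using e6_split[of b] sum_high_le b1 by simp
    also have "(c - b + 3) * (2 * h b) \<le> (c - b + 3) * ((b + 1) * (b + 2))"
      using h_b two_nz[of b] b1 bc by (intro mult_left_mono) auto
    also have "b * (b + 1) * (b + 2) + (c - b + 3) * ((b + 1) * (b + 2)) = (b + 1) * (b + 2) * (c + 3)"
      by (simp add: algebra_simps)
    also have "\<dots> \<le> ?M 1 * ?M 2 * ?M 3"
      using True M2 M3 b1 bc by (intro mult_mono3_int) auto
    finally show ?thesis by simp
  next
    case False
    \<comment> \<open>Only \<open>D 2\<close> can now contribute in degree \<open>b + 1\<close>, and
      it does so with a positive sign.\<close>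
    then have "b + 1 \<notin> set (D 1)" by (meson List.finite_set Max_ge)
    moreover have "b + 1 \<notin> set (D 3)" using D3_lower by force
    ultimately have "0 \<le> diff3 h (b + 1)" using euler[of "b + 1"] b1 by (simp add: count_eq_0)
    then have "3 * h b - h (b + 1) \<le> b * (b + 2)" using diff3_b1 by simp
    then have "(c - b + 2) * (3 * h b - h (b + 1)) \<le> (c - b + 2) * (b * (b + 2))"
      using bc by (intro mult_left_mono) auto
    then have "e6 \<le> b * (b + 1) * (b + 2) + (c - b + 2) * (b * (b + 2))"
      using e6_split[of b] sum_high_le' b1 by simp
    also have "\<dots> = b * (b + 2) * (c + 3)" by (simp add: algebra_simps)
    also have "\<dots> \<le> ?M 1 * ?M 2 * ?M 3"
      using M1 M2 M3 b1 bc by (intro mult_mono3_int) auto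
    finally show ?thesis .
  qed
qed

section \<open>The growth inequality and the lower bound for the multiplicity\<close>

context
  fixes p :: int
  assumes gr: "\<And>k. int (Suc k) * h (p - int (Suc k)) \<le> (int k + 3) * h (p - int k)"
begin

text \<open>Equality holds for \<open>h (p - k) = nz k\<close>. In the induction step the new term
  occurs \<open>k + 4\<close> times on the left: three copies are the new summand on the right, and
  the growth inequality bounds the other \<open>k + 1\<close> by the previous left-hand
  side.\<close>

lemma sum_growth_nat: "(int k + 3) * h (p - int k) \<le> 3 * (\<Sum>i\<in>{p - int k..p}. h i)"
proof (induction k)
  case (Suc k)
  have "{p - int (Suc k)..p} = insert (p - int (Suc k)) {p - int k..p}" by auto
  then have "3 * (\<Sum>i\<in>{p - int (Suc k)..p}. h i) = 3 * h (p - int (Suc k)) + 3 * (\<Sum>i\<in>{p - int k..p}. h i)"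
    by simp
  moreover have "(int (Suc k) + 3) * h (p - int (Suc k)) = 3 * h (p - int (Suc k)) + int (Suc k) * h (p - int (Suc k))"
    by (simp add: algebra_simps)
  ultimately show ?case using Suc.IH gr[of k] by linarith
qed simp

lemma sum_growth: "a \<le> p \<Longrightarrow> (p - a + 3) * h a \<le> 3 * (\<Sum>i\<in>{a..p}. h i)"
  using sum_growth_nat[of "nat (p - a)"] by simp

text \<open>The counterpart of \<open>sum_high_le'\<close> from below: \<open>sum_growth\<close> at
  \<open>a + 1\<close> provides two copies of \<open>(p - a + 2) * h (a + 1)\<close>; with the one
  subtracted on the left they outweigh \<open>3 * (p - a) * h a\<close> by the growth
  inequality.\<close>

lemma sum_growth':
  assumes "a \<le> p"
  shows "(p - a + 2) * (3 * h a - h (a + 1)) \<le> 6 * (\<Sum>i\<in>{a..p}. h i)"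
proof (cases "a = p")
  case True
  then show ?thesis using h_nonneg[of "p + 1"] by simp
next
  case False
  then have ap: "a < p" using assms by simp
  have "{a..p} = insert a {a + 1..p}" using assms by auto
  then have "6 * (\<Sum>i\<in>{a..p}. h i) = 6 * h a + 6 * (\<Sum>i\<in>{a + 1..p}. h i)" by simp
  moreover have "(p - a + 2) * h (a + 1) \<le> 3 * (\<Sum>i\<in>{a + 1..p}. h i)"
    using sum_growth[of "a + 1"] ap by (simp add: algebra_simps)
  moreover have "(p - a) * h a \<le> (p - a + 2) * h (a + 1)"
    using gr[of "nat (p - a - 1)"] ap by (simp add: algebra_simps)
  moreover have "(p - a + 2) * (3 * h a - h (a + 1)) =
      6 * h a + 3 * ((p - a) * h a) - (p - a + 2) * h (a + 1)"
    by (simp add: algebra_simps)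
  ultimately show ?thesis by linarith
qed

end

lemma sum_truncate: "p \<le> c \<Longrightarrow> (\<Sum>i\<in>{a..p}. h i) \<le> (\<Sum>i\<in>{a..c}. h i)"
  using h_nonneg by (intro sum_mono2) auto

text \<open>The cases follow what is known about \<open>h\<close> near \<open>b\<close>. If
  \<open>b\<close> is not a shift of \<open>D 1\<close>, then \<open>h b = nz b\<close>. If it is,
  and the least shift of \<open>D 2\<close> is at most \<open>b + 1\<close>, the growth estimate
  starts at \<open>b - 1\<close>, where \<open>h\<close> is known. Otherwise \<open>b + 1\<close> is
  no shift of \<open>D 2\<close>, and the third difference there bounds
  \<open>3 * h b - h (b + 1)\<close> from below.\<close>

theorem lower_bound: "Min (set (D 1)) * Min (set (D 2)) * Min (set (D 3)) \<le> e6"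
proof -
  let ?m = "\<lambda>i. Min (set (D i))"
  define p where "p = ?m 3 - 3"
  have m3: "?m 3 = p + 3" by (simp add: p_def)
  \<comment> \<open>The value \<open>p = b - 1\<close> is possible. The growth estimate from
    \<open>b\<close> on is then void, and the single term \<open>h b\<close> has to suffice.\<close>
  have pb: "b - 1 \<le> p" unfolding p_def using D3_lower[of "?m 3"] nonempty(3) Min_in by fastforce
  have pc: "p \<le> c" unfolding p_def using Min_le[OF _ top] by simp
  have gr: "int (Suc k) * h (p - int (Suc k)) \<le> (int k + 3) * h (p - int k)" for k
  proof (rule growth)
    show "d + 3 \<notin> set (D 3)" if "d < p" for d
    proof
      assume "d + 3 \<in> set (D 3)"
      then have "?m 3 \<le> d + 3" by simp
      then show False using that by (simp add: p_def)
    qed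
  qed
  have m2: "?m 2 \<le> b + 2" using mem_D2 by simp
  have "?m 2 \<in> set (D 2)" using nonempty(2) by (intro Min_in) auto
  then obtain j where j: "j \<in> set (D 1)" "j < ?m 2" using D12 by blast
  have m1: "?m 1 \<le> b + 1" using Min_le[OF _ j(1)] j(2) m2 by simp
  have pos: "0 \<le> ?m 1" "0 \<le> ?m 2" "0 \<le> ?m 3"
    using D1[of "?m 1"] D2_lower[of "?m 2"] D3_lower[of "?m 3"] nonempty b1 by (auto simp: Min_in)
  show ?thesis
  proof (cases "b \<in> set (D 1)")
    case False
    have "b \<notin> set (D 2)" "b \<notin> set (D 3)" using D2_lower D3_lower by force+
    then have "diff3 h b = 0" using euler[of b] False b1 by (simp add: count_eq_0)
    then have "h b = nz b"
      using diff3_nz[of b] h_low[of "b - 1"] h_low[of "b - 2"] h_low[of "b - 3"] b1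
      by (simp add: diff3_def)
    then have hb: "2 * h b = (b + 1) * (b + 2)" using two_nz[of b] b1 by simp
    have "(p - b + 3) * ((b + 1) * (b + 2)) \<le> 6 * (\<Sum>i\<in>{b..c}. h i)"
    proof (cases "b \<le> p")
      case True
      have "(p - b + 3) * (2 * h b) \<le> 6 * (\<Sum>i\<in>{b..p}. h i)"
        using sum_growth[OF gr True] by (simp add: algebra_simps)
      then show ?thesis using sum_truncate[OF pc, of b] unfolding hb by linarith
    next
      case False
      then have eq: "p - b + 3 = 2" using pb by simp
      have "h b \<le> (\<Sum>i\<in>{b..c}. h i)"
        using h_nonneg bc by (intro member_le_sum) auto
      then show ?thesis unfolding hb[symmetric] eq using h_nonneg[of b] by simp
    qed
    then have "(b + 1) * (b + 2) * (p + 3) \<le> e6"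
      using e6_split[of b] b1 by (simp add: algebra_simps)
    moreover have "?m 1 * ?m 2 * ?m 3 \<le> (b + 1) * (b + 2) * (p + 3)"
      using m1 m2 m3 pos by (intro mult_mono3_int) auto
    ultimately show ?thesis by simp
  next
    case True
    then have m1': "?m 1 \<le> b" by simp
    show ?thesis
    proof (cases "?m 2 \<le> b + 1")
      case m2': True
      have "(p - b + 4) * (2 * h (b - 1)) \<le> 6 * (\<Sum>i\<in>{b - 1..p}. h i)"
        using sum_growth[OF gr pb] by (simp add: algebra_simps)
      moreover have "2 * h (b - 1) = b * (b + 1)"
        using h_low[of "b - 1"] two_nz[of "b - 1"] b1 by simp
      ultimately have "(p - b + 4) * (b * (b + 1)) \<le> 6 * (\<Sum>i\<in>{b - 1..c}. h i)"
        using sum_truncate[OF pc, of "b - 1"] by simp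
      then have "b * (b + 1) * (p + 3) \<le> e6"
        using e6_split[of "b - 1"] b1 by (simp add: algebra_simps)
      moreover have "?m 1 * ?m 2 * ?m 3 \<le> b * (b + 1) * (p + 3)"
        using m1' m2' m3 pos by (intro mult_mono3_int) auto
      ultimately show ?thesis by simp
    next
      case m2': False
      then have "b + 1 \<notin> set (D 2)" by (meson List.finite_set Min_le)
      then have "diff3 h (b + 1) \<le> 0" using euler[of "b + 1"] b1 by (simp add: count_eq_0)
      then have w: "b * (b + 2) \<le> 3 * h b - h (b + 1)" using diff3_b1 by simp
      have "(p - b + 2) * (b * (b + 2)) \<le> 6 * (\<Sum>i\<in>{b..c}. h i)"
      proof (cases "b \<le> p")
        case True
        have "(p - b + 2) * (b * (b + 2)) \<le> (p - b + 2) * (3 * h b - h (b + 1))"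
          using w True by (intro mult_left_mono) auto
        also have "\<dots> \<le> 6 * (\<Sum>i\<in>{b..p}. h i)" by (rule sum_growth'[OF gr True])
        finally show ?thesis using sum_truncate[OF pc, of b] by linarith
      next
        case False
        \<comment> \<open>The factor \<open>p - b + 2\<close> is 1 here, so the claim follows from
          \<open>3 * h b - h (b + 1) \<le> 6 * h b\<close>.\<close>
        then have "p = b - 1" using pb by simp
        moreover have "h b \<le> (\<Sum>i\<in>{b..c}. h i)"
          using h_nonneg bc by (intro member_le_sum) auto
        ultimately show ?thesis using w h_nonneg[of b] h_nonneg[of "b + 1"] by simp
      qed
      then have "b * (b + 2) * (p + 3) \<le> e6"
        using e6_split[of b] b1 by (simp add: algebra_simps)
      moreover have "?m 1 * ?m 2 * ?m 3 \<le> b * (b + 2) * (p + 3)"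
        using m1' m2 m3 pos by (intro mult_mono3_int) auto
      ultimately show ?thesis by simp
    qed
  qed
qed

end

section \<open>From the compressed algebra to the numerical data\<close>

lemma num_monos_mono: "num_monos 3 n \<le> num_monos 3 (Suc n)"
proof -
  have "3 + Suc n - 1 = Suc (n + 2)" "3 + n - 1 = n + 2" by simp_all
  then show ?thesis unfolding num_monos_def by (simp only: binomial_Suc_Suc le_add1)
qed

text \<open>Raising \<open>d\<close> lowers the coefficients of the subtracted sum and drops its
  first term, while \<open>num_monos 3 d\<close> does not decrease. Monotonicity decides which
  argument of the minimum for the h-vector is attained on either side of \<open>b\<close>.\<close>

lemma compr_r_Suc_le: "compr_r 3 s d \<le> compr_r 3 s (Suc d)"
proof -
  let ?c = "length s - 1"
  have "(\<Sum>i = Suc d..?c. int (num_monos 3 (i - Suc d)) * int (s ! i))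
      \<le> (\<Sum>i = Suc d..?c. int (num_monos 3 (i - d)) * int (s ! i))"
  proof (intro sum_mono mult_right_mono)
    fix i assume "i \<in> {Suc d..?c}"
    then have "i - d = Suc (i - Suc d)" by auto
    then show "int (num_monos 3 (i - Suc d)) \<le> int (num_monos 3 (i - d))"
      using num_monos_mono by simp
  qed simp
  also have "\<dots> \<le> (\<Sum>i = d..?c. int (num_monos 3 (i - d)) * int (s ! i))"
    by (rule sum_mono2) auto
  finally show ?thesis
    unfolding compr_r_def using num_monos_mono[of d] by linarith
qed

lemma compr_r_mono: "d \<le> d' \<Longrightarrow> compr_r 3 s d \<le> compr_r 3 s d'"
  by (rule lift_Suc_mono_le[of "compr_r 3 s", OF compr_r_Suc_le])

lemma sum_int_atLeastAtMost: "(\<Sum>j\<in>{int a..int c}. f j) = (\<Sum>i = a..c. f (int i))"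
  by (rule sum.reindex_bij_witness[of _ int nat]) auto

lemma int_sum_num_forms: "int (\<Sum>j\<leftarrow>L. num_forms 3 (d - j)) = (\<Sum>j\<leftarrow>L. nz (d - j))"
  by (induction L) (auto simp: num_forms_3)

lemma nz_of_nat: "nz (int n) = int (num_monos 3 n)"
  using num_forms_3[of "int n"] by (simp add: num_forms_def)

theorem theorem2p7:
  fixes I' :: "'k::field_char_0 mpoly set"
    and D :: "nat \<Rightarrow> int list"
    and \<phi> :: "nat \<Rightarrow> (nat \<Rightarrow> 'k mpoly) \<Rightarrow> (nat \<Rightarrow> 'k mpoly)"
    and m M :: "nat \<Rightarrow> int" and e :: nat
  assumes "std_artinian_algebra 3 I'" and "codimension 3 I' = 3"
    and "\<exists>r s. \<exists>I :: 'k mpoly set. compressed_algebra r s I \<and> h_vector 3 I' = h_vector r I"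
    and "minimal_graded_free_resolution 3 I' D \<phi>"
    and "e = alg_multiplicity 3 I'"
    and "\<And>i. i \<in> {1, 2, 3} \<Longrightarrow> m i = Min (set (D i))"
    and "\<And>i. i \<in> {1, 2, 3} \<Longrightarrow> M i = Max (set (D i))"
  shows "real_of_int (m 1 * m 2 * m 3) / 6 \<le> real e \<and>
         real e \<le> real_of_int (M 1 * M 2 * M 3) / 6"
proof -
  obtain r s and I :: "'k mpoly set" where comp: "compressed_algebra r s I"
    and hv: "h_vector 3 I' = h_vector r I"
    using assms(3) by blast
  interpret A: std_algebra 3 I' by unfold_locales (rule assms(1))
  interpret R: resolution3 I' D \<phi> by unfold_locales (rule assms(4))
  define c where "c = socle_degree 3 I'"
  define h where "h i = int (A.H i)" for i
  \<comment> \<open>Equal h-vectors have equal length, hence both algebras have the same socle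
    degree.\<close>
  have "length (h_vector 3 I') = length (h_vector r I)" using hv by simp
  then have c': "socle_degree r I = c" by (simp add: h_vector_def c_def)
  have hilb_c: "hilb 3 I' i = hilb r I i" if "i \<le> c" for i
  proof -
    have "h_vector 3 I' ! i = h_vector r I ! i" using hv by simp
    then show ?thesis using that c' by (simp add: h_vector_def c_def nth_append del: upt_Suc)
  qed
  \<comment> \<open>Since this value is not 0, the index 1 lies within the h-vectors; comparing the
    entries there shows that the compressed algebra also has codimension 3.\<close>
  have H1: "A.H 1 = 3" using assms(2) A.hilb_eq[of 1] by (simp add: codimension_def)
  have c1: "1 \<le> c"
  proof (rule ccontr)
    assume "\<not> 1 \<le> c"
    then have "forms 3 (int 1) \<subseteq> I'" using A.socle_degree_props(2)[of 1] by (simp add: c_def)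
    then show False using A.H_eq_0[of 1] H1 by simp
  qed
  have r: "r = 3"
    using comp hilb_c[OF c1] assms(2) by (simp add: compressed_algebra_def codimension_def)
  have lens: "length s - 1 = c"
    using comp c' by (auto simp: compressed_algebra_def socle_vector_def)
  obtain b where b: "1 \<le> b" "b \<le> c" "compr_r 3 s b \<ge> 0" "compr_r 3 s (b - 1) < 0"
    "\<And>i. 1 \<le> i \<Longrightarrow> i < b \<Longrightarrow> s ! i = 0"
    using comp unfolding compressed_algebra_def lens r by blast
  have hH: "h (int i) = min (nz (int i) - compr_r 3 s i) (nz (int i))" if "i \<le> c" for i
  proof -
    have "int (hilb 3 I' i) = min (int (num_monos 3 i) - compr_r 3 s i) (int (num_monos 3 i))"
      using comp that hilb_c[OF that] unfolding compressed_algebra_def lens r by simp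
    then show ?thesis by (simp add: h_def A.hilb_eq nz_of_nat)
  qed
  have h_high_c: "h i = 0" if "int c < i" for i
  proof -
    have "forms 3 (int (nat i)) \<subseteq> I'" using that by (intro A.socle_degree_props(2)) (simp add: c_def)
    then show ?thesis using A.H_eq_0[of i] that by (simp add: h_def)
  qed
  have h_low: "h i = nz i" if i: "i < int b" for i
  proof (cases "i < 0")
    case True
    then have "forms 3 i \<subseteq> I'" using mp.subspace_0[OF A.subspace_ideal] by (simp add: forms_neg)
    then show ?thesis using A.H_eq_0[of i] True by (simp add: h_def nz_neg)
  next
    case False
    define n where "n = nat i"
    have n: "i = int n" "n \<le> b - 1" "n \<le> c" using False i b(2) by (auto simp: n_def)
    have "compr_r 3 s n \<le> 0" using compr_r_mono[OF n(2), of s] b(4) by simp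
    then show ?thesis using hH[OF n(3)] n(1) by simp
  qed
  define \<sigma> where "\<sigma> j = int (s ! nat j)" for j :: int
  have cr: "compr_r 3 s n = nz (int n) - (\<Sum>j\<in>{int n..int c}. \<sigma> j * nz (j - int n))" for n
  proof -
    have "(\<Sum>j\<in>{int n..int c}. \<sigma> j * nz (j - int n)) = (\<Sum>i = n..c. \<sigma> (int i) * nz (int i - int n))"
      by (rule sum_int_atLeastAtMost)
    also have "\<dots> = (\<Sum>i = n..c. int (num_monos 3 (i - n)) * int (s ! i))"
    proof (intro sum.cong refl)
      fix i assume "i \<in> {n..c}"
      then have "int i - int n = int (i - n)" by auto
      then show "\<sigma> (int i) * nz (int i - int n) = int (num_monos 3 (i - n)) * int (s ! i)"
        by (simp add: \<sigma>_def nz_of_nat del: of_nat_diff)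
    qed
    finally show ?thesis unfolding compr_r_def lens by (simp add: nz_of_nat)
  qed
  have h_high: "h i = (\<Sum>j\<in>{int b..int c}. \<sigma> j * nz (j - i))" if i: "int b \<le> i" for i
  proof (cases "i \<le> int c")
    case True
    define n where "n = nat i"
    have n: "i = int n" "b \<le> n" "n \<le> c" using i True by (auto simp: n_def)
    have "0 \<le> compr_r 3 s n" using compr_r_mono[OF n(2), of s] b(3) by simp
    then have "h i = (\<Sum>j\<in>{i..int c}. \<sigma> j * nz (j - i))"
      using hH[OF n(3)] cr[of n] n(1) by simp
    also have "\<dots> = (\<Sum>j\<in>{int b..int c}. \<sigma> j * nz (j - i))"
      using i by (intro sum.mono_neutral_left) (auto simp: nz_neg)
    finally show ?thesis .
  next
    case False
    then have "(\<Sum>j\<in>{int b..int c}. \<sigma> j * nz (j - i)) = 0"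
      by (intro sum.neutral) (simp add: nz_neg)
    then show ?thesis using h_high_c[of i] False by simp
  qed
  \<comment> \<open>For \<open>b > 1\<close> this is \<open>compr_r 3 s (b - 1) < 0\<close>, with
    the term of \<open>s ! (b - 1) = 0\<close> left out. For \<open>b = 1\<close> the left-out term
    would be that of \<open>s ! 0\<close>, which the condition on \<open>b\<close> does not cover;
    there the sum is at least \<open>h 1 = 3\<close>.\<close>
  have second: "nz (int b - 1) < (\<Sum>j\<in>{int b..int c}. \<sigma> j * nz (j - int b + 1))"
  proof (cases "b = 1")
    case True
    have "3 = (\<Sum>j\<in>{int b..int c}. \<sigma> j * nz (j - 1))"
      using h_high[of 1] H1 True by (simp add: h_def)
    also have "\<dots> \<le> (\<Sum>j\<in>{int b..int c}. \<sigma> j * nz (j - int b + 1))"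
    proof (intro sum_mono mult_left_mono)
      fix j assume "j \<in> {int b..int c}"
      then have "2 * nz (j - 1) \<le> 2 * nz j"
        using two_nz[of j] two_nz[of "j - 1"] True by (simp add: algebra_simps)
      then show "nz (j - 1) \<le> nz (j - int b + 1)" using True by simp
    qed (simp add: \<sigma>_def)
    finally show ?thesis using True by (simp add: nz_def)
  next
    case False
    have "{int (b - 1)..int c} = insert (int b - 1) {int b..int c}" using b by auto
    moreover have "\<sigma> (int b - 1) = 0"
    proof -
      have "nat (int b - 1) = b - 1" by simp
      then show ?thesis unfolding \<sigma>_def using b(1) b(5)[of "b - 1"] False by simp
    qed
    ultimately have "(\<Sum>j\<in>{int (b - 1)..int c}. \<sigma> j * nz (j - int (b - 1))) =
        (\<Sum>j\<in>{int b..int c}. \<sigma> j * nz (j - int b + 1))"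
      using b(1) by (simp add: of_nat_diff algebra_simps)
    then show ?thesis using cr[of "b - 1"] b(1,4) by (simp add: of_nat_diff)
  qed
  \<comment> \<open>The contrapositive of \<open>R.socle_shift\<close>: where \<open>D 3\<close>
    lacks the shift \<open>d + 3\<close>, there is no socle in degree \<open>d\<close>. It yields
    both the top shift and the growth inequality.\<close>
  have socle: "f \<in> I'" if "d + 3 \<notin> set (D 3)" "f \<in> forms 3 d" "\<And>k. k < 3 \<Longrightarrow> var k * f \<in> I'" for d f
    using R.socle_shift[of f d] that by blast
  interpret C: compressed_shifts h \<sigma> "int b" "int c" D
  proof
    show "1 \<le> int b" "int b \<le> int c" using b by simp_all
    show "0 \<le> \<sigma> j" for j by (simp add: \<sigma>_def)
    show "0 \<le> h i" for i by (simp add: h_def)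
    show "h i = nz i" if "i < int b" for i by (rule h_low[OF that])
    show "h i = (\<Sum>j\<in>{int b..int c}. \<sigma> j * nz (j - i))" if "int b \<le> i" for i by (rule h_high[OF that])
    show "h (int b) \<le> nz (int b)" using hH[OF b(2)] by simp
    show "nz (int b - 1) < (\<Sum>j\<in>{int b..int c}. \<sigma> j * nz (j - int b + 1))" by (rule second)
    show "int b \<le> j" if "j \<in> set (D 1)" for j
    proof (rule R.shifts1_lower[OF _ that])
      show "I' \<inter> forms 3 j \<subseteq> {0}" if "j < int b" for j
      proof (rule A.ideal_forms_trivial)
        have "int (A.H j) = int (num_forms 3 j)" using h_low[OF that] by (simp add: h_def num_forms_3)
        then show "A.H j = num_forms 3 j" by simp
      qed
    qed
    show "\<exists>j'\<in>set (D 1). j' < j" if "j \<in> set (D 2)" for j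
      using R.shifts_increase[of 1 j] that by (simp add: numeral_2_eq_2)
    show "\<exists>j'\<in>set (D 2). j' < j" if "j \<in> set (D 3)" for j
      using R.shifts_increase[of 2 j] that by (simp add: numeral_3_eq_3 numeral_2_eq_2)
    show "diff3 h d = (if d = 0 then 1 else 0) - int (count_list (D 1) d)
        + int (count_list (D 2) d) - int (count_list (D 3) d)" for d
    proof -
      let ?S = "\<lambda>i d. \<Sum>j\<leftarrow>D i. nz (d - j)"
      have "h d = nz d - ?S 1 d + ?S 2 d - ?S 3 d" for d
        using A.dim_forms_nf[of d] R.dim_ideal_piece[of d]
        unfolding int_sum_num_forms num_forms_3[symmetric, of d] h_def by linarith
      then have "h = (\<lambda>d. nz d - ?S 1 d + ?S 2 d - ?S 3 d)" by blast
      then have "diff3 h d = diff3 nz d - diff3 (?S 1) d + diff3 (?S 2) d - diff3 (?S 3) d"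
        by (simp add: diff3_def)
      then show ?thesis by (simp only: diff3_nz diff3_sum_list)
    qed
    show "int c + 3 \<in> set (D 3)"
    proof (rule ccontr)
      assume no: "int c + 3 \<notin> set (D 3)"
      \<comment> \<open>Products with variables land in degree \<open>c + 1\<close>, which lies in
        the ideal, so every form of degree \<open>c\<close> represents a socle element.\<close>
      have "forms 3 (int c) \<subseteq> I'"
      proof
        fix f :: "'k mpoly" assume f: "f \<in> forms 3 (int c)"
        show "f \<in> I'"
        proof (rule socle[OF no f])
          fix k :: nat assume "k < 3"
          then have "var k * f \<in> forms 3 (int (Suc c))"
            using forms_mult[OF var_forms f, of k] by simp
          then show "var k * f \<in> I'" using A.socle_degree_props(2)[of "Suc c"] by (auto simp: c_def)
        qed
      qed
      then show False using A.socle_degree_props(1) by (simp add: c_def)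
    qed
    show "int (Suc k) * h (p - int (Suc k)) \<le> (int k + 3) * h (p - int k)"
      if "\<And>d. d < p \<Longrightarrow> d + 3 \<notin> set (D 3)" for p k
    proof -
      have "Suc k * A.H (p - int (Suc k)) \<le> (k + 3) * A.H (p - int k)"
        by (rule A.hilbert_growth) (use that socle in blast)
      then have "int (Suc k * A.H (p - int (Suc k))) \<le> int ((k + 3) * A.H (p - int k))"
        by (simp only: of_nat_le_iff)
      then show ?thesis by (simp only: h_def of_nat_mult of_nat_add of_nat_numeral)
    qed
  qed
  have "int e = (\<Sum>i\<in>{0..c}. h (int i))"
  proof -
    have "e = (\<Sum>i\<leftarrow>[0..<Suc c]. hilb 3 I' i)"
      using assms(5) by (simp add: alg_multiplicity_def h_vector_def c_def)
    also have "\<dots> = (\<Sum>i\<in>{0..c}. A.H (int i))"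
      by (simp only: A.hilb_eq interv_sum_list_conv_sum_set_nat atLeastLessThanSuc_atLeastAtMost set_upt)
    finally show ?thesis by (simp add: h_def)
  qed
  then have e: "C.e6 = 6 * int e"
    unfolding C.e6_def using sum_int_atLeastAtMost[of h 0 c] by simp
  have "m 1 * m 2 * m 3 \<le> 6 * int e" using C.lower_bound e assms(6) by simp
  moreover have "6 * int e \<le> M 1 * M 2 * M 3" using C.upper_bound e assms(7) by simp
  ultimately have "real_of_int (m 1 * m 2 * m 3) \<le> 6 * real e \<and> 6 * real e \<le> real_of_int (M 1 * M 2 * M 3)"
    by linarith
  then show ?thesis by simp
qed

end
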